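(* Let $\mathbb{K}=\mathbb{R}$ or $\mathbb{C}$ and let $F(z,w)=\sum_{\alpha\in\mathbb{N}^n}P_\alpha(z)w^\alpha$, where $z=(z_1,\ldots,z_n)$, $w=(w_1,\ldots,w_n)$, be a formal power series in $w$ with coefficients $P_\alpha\in\mathbb{K}[z_1,\ldots,z_n]$. Then $F(z,w)\in\overline{\mathcal{H}}_{2n}(\mathbb{K})$ if and only if $$\sum_{\alpha\le\beta}(\beta)_\alpha P_\alpha(z)w^\alpha\in\mathcal{H}_{2n}(\mathbb{K})\cup\{0\}$$ for all $\beta\in\mathbb{N}^n$.
   Context: $H=\{z\in\mathbb{C}:\Im(z)>0\}$. $\mathcal{H}_m(\mathbb{C})$ is the set of polynomials in $m$ variables that are non-zero whenever all variables lie in $H$, and $\mathcal{H}_m(\mathbb{R})$ those with real coefficients. $\overline{\mathcal{H}}_m(\mathbb{C})$ is the class of entire functions in $m$ variables that are limits, uniformly on compact sets, of polynomials in $\mathcal{H}_m(\mathbb{C})$; $\overline{\mathcal{H}}_m(\mathbb{R})$ consists of those with real coefficients. A formal power series belongs to such a class if it defines an entire function in it. $\alpha\le\beta$ means $\alpha_i\le\beta_i$ for all $i$; $(\beta)_\alpha=\beta!/(\beta-\alpha)!$ if $\alpha\le\beta$ and $0$ otherwise, with $\beta!=\prod\beta_i!$. *)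

theory Defs
  imports "HOL-Analysis.Analysis"
begin

text \<open>Points of complex m-space are vectors indexed by a finite type 'v (so m = CARD('v));
multi-indices are functions 'v \<Rightarrow> nat. K is the coefficient field, given as a subset
of the complex numbers (\<real> or UNIV).\<close>

definition monom :: "('v::finite \<Rightarrow> nat) \<Rightarrow> complex ^ 'v \<Rightarrow> complex" where
  "monom \<alpha> x = (\<Prod>i\<in>UNIV. (x $ i) ^ (\<alpha> i))"

definition is_poly :: "complex set \<Rightarrow> (complex ^ 'v::finite \<Rightarrow> complex) \<Rightarrow> bool" where
  "is_poly K p \<longleftrightarrow> (\<exists>c. finite {\<alpha>. c \<alpha> \<noteq> 0} \<and> (\<forall>\<alpha>. c \<alpha> \<in> K) \<and>
      (\<forall>x. p x = (\<Sum>\<alpha>\<in>{\<alpha>. c \<alpha> \<noteq> 0}. c \<alpha> * monom \<alpha> x)))"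

definition Hstab :: "complex set \<Rightarrow> (complex ^ 'v::finite \<Rightarrow> complex) set" where
  "Hstab K = {p. is_poly K p \<and> (\<forall>x. (\<forall>i. Im (x $ i) > 0) \<longrightarrow> p x \<noteq> 0)}"

definition has_coeffs :: "(complex ^ 'v::finite \<Rightarrow> complex) \<Rightarrow> (('v \<Rightarrow> nat) \<Rightarrow> complex) \<Rightarrow> bool" where
  "has_coeffs f c \<longleftrightarrow> (\<forall>x. ((\<lambda>\<alpha>. c \<alpha> * monom \<alpha> x) has_sum f x) UNIV)"

definition Hbar :: "complex set \<Rightarrow> (complex ^ 'v::finite \<Rightarrow> complex) set" where
  "Hbar K = {f. (\<exists>c. has_coeffs f c \<and> (\<forall>\<alpha>. c \<alpha> \<in> K)) \<and>
      (\<exists>ps. (\<forall>k. ps k \<in> Hstab UNIV) \<and>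
            (\<forall>S. compact S \<longrightarrow> uniform_limit S ps f sequentially))}"

definition fps_in :: "(('v::finite \<Rightarrow> nat) \<Rightarrow> complex) \<Rightarrow> (complex ^ 'v \<Rightarrow> complex) set \<Rightarrow> bool" where
  "fps_in c A \<longleftrightarrow> (\<exists>f. has_coeffs f c \<and> f \<in> A)"

definition ffact_multi :: "('n::finite \<Rightarrow> nat) \<Rightarrow> ('n \<Rightarrow> nat) \<Rightarrow> nat" where
  "ffact_multi \<beta> \<alpha> = (if \<alpha> \<le> \<beta> then (\<Prod>i\<in>UNIV. fact (\<beta> i) div fact (\<beta> i - \<alpha> i)) else 0)"

definition zpart :: "complex ^ ('n::finite + 'n) \<Rightarrow> complex ^ 'n" where
  "zpart x = (\<chi> i. x $ Inl i)"
definition wpart :: "complex ^ ('n::finite + 'n) \<Rightarrow> complex ^ 'n" where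
  "wpart x = (\<chi> i. x $ Inr i)"

text \<open>F(z,w) = \<Sum>_\<alpha> P_\<alpha>(z) w^\<alpha> with P_\<alpha>(z) = \<Sum>_\<gamma> a \<gamma> \<alpha> z^\<gamma>; joint coefficient of z^\<gamma> w^\<alpha>\<close>
definition joint_coeff :: "(('n::finite \<Rightarrow> nat) \<Rightarrow> ('n \<Rightarrow> nat) \<Rightarrow> complex) \<Rightarrow> ('n + 'n \<Rightarrow> nat) \<Rightarrow> complex" where
  "joint_coeff a \<delta> = a (\<delta> \<circ> Inl) (\<delta> \<circ> Inr)"

definition Pcoef :: "(('n::finite \<Rightarrow> nat) \<Rightarrow> ('n \<Rightarrow> nat) \<Rightarrow> complex) \<Rightarrow> ('n \<Rightarrow> nat) \<Rightarrow> complex ^ 'n \<Rightarrow> complex" where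
  "Pcoef a \<alpha> z = (\<Sum>\<gamma>\<in>{\<gamma>. a \<gamma> \<alpha> \<noteq> 0}. a \<gamma> \<alpha> * monom \<gamma> z)"

definition trunc_poly :: "(('n::finite \<Rightarrow> nat) \<Rightarrow> ('n \<Rightarrow> nat) \<Rightarrow> complex) \<Rightarrow> ('n \<Rightarrow> nat) \<Rightarrow> complex ^ ('n + 'n) \<Rightarrow> complex" where
  "trunc_poly a \<beta> x = (\<Sum>\<alpha>\<in>{\<alpha>. \<alpha> \<le> \<beta>}. of_nat (ffact_multi \<beta> \<alpha>) * Pcoef a \<alpha> (zpart x) * monom \<alpha> (wpart x))"

end

theory Submission
  imports Defs "HOL-Complex_Analysis.Complex_Analysis"
    "HOL-Computational_Algebra.Fundamental_Theorem_Algebra"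
begin

unbundle no fps_syntax

text \<open>Forward direction: multiplying the coefficients by the falling factorials \<open>(\<beta>)\<^sub>\<alpha>\<close> preserves
  stability of polynomials up to the zero polynomial, since in one variable \<open>q(d/ds) s\<^sup>b\<close> has no
  zeros in the lower half-plane when \<open>q\<close> has none in the upper one. Cauchy estimates and Hurwitz's
  theorem carry this over to locally uniform limits.

  Backward direction: the given polynomials for \<open>\<beta> = (k, \<dots>, k)\<close>, taken at \<open>(z, w/k)\<close>, are stable and
  converge to the series coefficientwise, with coefficients dominated by those of the series.
  Let \<open>r\<close> be the least total degree that occurs. The homogeneous part of degree \<open>r\<close> is
  stable, hence has no zeros at positive real points, and along a positive real direction Szasz's
  inequality bounds all further homogeneous parts by those of degree \<open>r\<close>, \<open>r + 1\<close>, \<open>r + 2\<close>.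
  Finite differences turn bounds on the box \<open>[1,2]\<^sup>m\<close> into bounds on the coefficients, so the series is
  entire and the convergence is locally uniform.\<close>

section \<open>Stable univariate polynomials\<close>

text \<open>The backward direction starts from a formal series whose growth is unknown: each P_alpha
  has its own degree, so entireness must come from stability alone. Szasz's inequality can supply it
  because its bound involves the lowest three coefficients but not the degree, and so survives a
  limit along polynomials of unbounded degree. Its radius R is arbitrary, and a coefficient bound B
  (E/R)^|alpha| for every R > 0, with E fixed and B depending on R, is what an entire series needs.
  The lowest homogeneous part is known to be nonzero only at positive real points; on a torus it may
  vanish, as z + w does. This is why the coefficients are recovered by finite differences on a real
  box and not by a Cauchy integral. The approximants carry the factors (k)_alpha / k^|alpha|, which
  lie in [0,1] and tend to 1. The upper bound 1 serves twice: it keeps the approximants free of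
  terms of degree below r, and it makes the limit series a majorant for the uniform
  convergence.\<close>

lemma stable_poly_factorization:
  fixes p :: "complex poly"
  assumes "coeff p 0 \<noteq> 0" and "\<And>t. Im t > 0 \<Longrightarrow> poly p t \<noteq> 0"
  shows "\<exists>etas. (\<forall>\<eta>\<in>set etas. Im \<eta> \<ge> 0) \<and> p = smult (coeff p 0) (\<Prod>\<eta>\<leftarrow>etas. [:1, -\<eta>:])"
  using assms
proof (induction "degree p" arbitrary: p)
  case 0
  then obtain c where "p = [:c:]" by (metis degree_eq_zeroE)
  then show ?case by (intro exI[of _ "[]"]) simp
next
  case (Suc n)
  obtain \<xi> where \<xi>: "poly p \<xi> = 0"
    using alg_closed_imp_poly_has_root[of p] Suc.hyps(2) by auto
  have \<xi>0: "\<xi> \<noteq> 0" using \<xi> Suc.prems(1) by (auto simp: poly_0_coeff_0)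
  obtain q where q: "p = [:-\<xi>, 1:] * q" using \<xi> by (auto simp: poly_eq_0_iff_dvd)
  define r where "r = smult (-\<xi>) q"
  \<comment> \<open>Factors are normalised to the value 1 at 0. The low coefficients of
    \<open>p\<close> then become symmetric functions of the reciprocals of its roots, and these
    reciprocals lie in the closed upper half-plane.\<close>
  have "[:-\<xi>, 1:] = smult (-\<xi>) [:1, -(1/\<xi>):]" using \<xi>0 by simp
  then have pr: "p = [:1, -(1/\<xi>):] * r"
    by (simp only: q r_def mult_smult_left mult_smult_right)
  have "Im \<xi> \<le> 0" using Suc.prems(2)[of \<xi>] \<xi> by force
  then have im: "Im (1/\<xi>) \<ge> 0" by (simp add: Im_divide divide_nonpos_nonneg)
  have "r \<noteq> 0" using Suc.prems(1) pr by auto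
  then have "n = degree r" using Suc.hyps(2) \<xi>0 by (simp add: pr degree_mult_eq del: mult_pCons_left)
  moreover have c0: "coeff r 0 = coeff p 0" by (simp add: pr)
  moreover have "poly r t \<noteq> 0" if "Im t > 0" for t
    using Suc.prems(2)[OF that] unfolding pr by auto
  ultimately obtain etas where e: "\<forall>\<eta>\<in>set etas. Im \<eta> \<ge> 0"
      "r = smult (coeff r 0) (\<Prod>\<eta>\<leftarrow>etas. [:1, -\<eta>:])"
    using Suc.hyps(1)[of r] Suc.prems(1) by auto
  have "p = smult (coeff p 0) (\<Prod>\<eta>\<leftarrow>(1/\<xi>) # etas. [:1, -\<eta>:])"
    by (subst pr, subst e(2)) (simp only: c0 mult_smult_right list.map prod_list.Cons)
  then show ?case using e(1) im by (intro exI[of _ "(1/\<xi>) # etas"]) auto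
qed

text \<open>By partial fractions g'/g is the sum of 1/(s - \<xi>) over the roots \<xi>. Since Im s <
  0 \<le> Im \<xi>, each s - \<xi> lies in the lower half-plane and its reciprocal in the upper
  one.\<close>

lemma Im_log_deriv_pos:
  fixes g :: "complex poly"
  assumes "\<And>s. Im s < 0 \<Longrightarrow> poly g s \<noteq> 0" and "degree g > 0" and "Im s < 0"
  shows "Im (poly (pderiv g) s / poly g s) > 0"
  using assms
proof (induction "degree g" arbitrary: g)
  case 0
  then show ?case by simp
next
  case (Suc n)
  obtain \<xi> where \<xi>: "poly g \<xi> = 0"
    using alg_closed_imp_poly_has_root[of g] Suc.hyps(2) by auto
  obtain q where q: "g = [:-\<xi>, 1:] * q" using \<xi> by (auto simp: poly_eq_0_iff_dvd)
  have nz: "poly q s \<noteq> 0" if "Im s < 0" for s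
    using Suc.prems(1)[OF that] unfolding q by auto
  have "Im \<xi> \<ge> 0" using Suc.prems(1)[of \<xi>] \<xi> by force
  then have sx: "Im (s - \<xi>) < 0" "s - \<xi> \<noteq> 0" using Suc.prems(3) by auto
  have pos: "Im (1/(s-\<xi>)) > 0"
    using sx by (simp add: Im_divide divide_neg_pos sum_power2_gt_zero_iff complex_eq_iff)
  have "q \<noteq> 0" using Suc.hyps(2) q by auto
  then have n: "n = degree q" using Suc.hyps(2) by (simp add: q degree_mult_eq del: mult_pCons_left)
  have eq: "poly (pderiv g) s / poly g s = 1/(s-\<xi>) + poly (pderiv q) s / poly q s"
    using sx nz[OF Suc.prems(3)]
    by (simp add: q pderiv_mult pderiv_pCons divide_simps del: mult_pCons_left)
  show ?case
  proof (cases "n = 0")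
    case True
    then have "pderiv q = 0" using n by (simp add: pderiv_eq_0_iff)
    then show ?thesis using pos by (simp add: eq)
  next
    case False
    then have "Im (poly (pderiv q) s / poly q s) > 0"
      using Suc.hyps(1)[OF n nz _ Suc.prems(3)] False n by simp
    then show ?thesis using pos by (simp add: eq)
  qed
qed

text \<open>A zero s would give g'(s)/g(s) = 1/\<eta>, where the left side has positive imaginary
  part and the right side does not.\<close>

lemma poly_minus_pderiv_nonzero:
  fixes g :: "complex poly"
  assumes g: "\<And>s. Im s < 0 \<Longrightarrow> poly g s \<noteq> 0" and "Im \<eta> \<ge> 0" and s: "Im s < 0"
  shows "poly (g - smult \<eta> (pderiv g)) s \<noteq> 0"
proof
  assume "poly (g - smult \<eta> (pderiv g)) s = 0"
  then have eq: "\<eta> * (poly (pderiv g) s / poly g s) = 1" using g[OF s] by simp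
  then have "pderiv g \<noteq> 0" by auto
  then have "Im (poly (pderiv g) s / poly g s) > 0"
    using Im_log_deriv_pos[OF g _ s] by (auto simp: pderiv_eq_0_iff)
  moreover have "poly (pderiv g) s / poly g s = 1 / \<eta>"
    using eq by (metis mult_zero_left nonzero_eq_divide_eq mult.commute zero_neq_one)
  moreover have "Im (1/\<eta>) \<le> 0" using assms(2) by (simp add: Im_divide divide_nonpos_nonneg)
  ultimately show False by simp
qed

text \<open>This is q(d/ds) applied to \<open>g\<close> as soon as \<open>N\<close> bounds the
  degree of \<open>q\<close>. The cut-off is separate from the degree because the induction counts
  linear factors, and a factor with \<eta> = 0 does not raise the degree.\<close>

definition poly_deriv_op :: "nat \<Rightarrow> complex poly \<Rightarrow> complex poly \<Rightarrow> complex poly" where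
  "poly_deriv_op N q g = (\<Sum>l\<le>N. smult (coeff q l) ((pderiv ^^ l) g))"

text \<open>Passing from q to q(d/ds) is multiplicative, so the factor 1 - \<eta> t may act on
  \<open>g\<close> first. This feeds the induction over the factors.\<close>

lemma poly_deriv_op_mult:
  assumes "degree q \<le> N"
  shows "poly_deriv_op (Suc N) ([:1, -\<eta>:] * q) g = poly_deriv_op N q (g - smult \<eta> (pderiv g))"
proof -
  have 1: "poly_deriv_op (Suc N) q h = poly_deriv_op N q h" for h
    using assms by (simp add: poly_deriv_op_def coeff_eq_0)
  have 2: "poly_deriv_op (Suc N) (pCons 0 q) h = poly_deriv_op N q (pderiv h)" for h
    unfolding poly_deriv_op_def by (subst sum.atMost_Suc_shift) (simp add: funpow_swap1)
  have "poly_deriv_op (Suc N) ([:1, -\<eta>:] * q) g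
      = poly_deriv_op (Suc N) q g - smult \<eta> (poly_deriv_op (Suc N) (pCons 0 q) g)"
  proof -
    have eq: "[:1, -\<eta>:] * q = q - smult \<eta> (pCons 0 q)" by simp
    show ?thesis unfolding eq
      by (intro poly_eqI) (simp add: poly_deriv_op_def coeff_sum sum_distrib_left algebra_simps
          flip: sum_subtractf del: sum.atMost_Suc mult_pCons_left smult_pCons)
  qed
  also have "\<dots> = poly_deriv_op N q g - smult \<eta> (poly_deriv_op N q (pderiv g))"
    unfolding 1 2 ..
  also have "\<dots> = poly_deriv_op N q (g - smult \<eta> (pderiv g))"
    by (rule poly_eqI) (simp add: poly_deriv_op_def coeff_sum coeff_higher_pderiv sum_distrib_left
        algebra_simps flip: sum_subtractf)
  finally show ?thesis .
qed

lemma degree_prod_linear_le: "degree (\<Prod>\<eta>\<leftarrow>etas. [:1, -\<eta>:]) \<le> length etas"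
  for etas :: "complex list"
proof (induction etas)
  case (Cons a etas)
  have "degree ([:1, -a:] * (\<Prod>\<eta>\<leftarrow>etas. [:1, -\<eta>:])) \<le> 1 + length etas"
    by (rule order_trans[OF degree_mult_le]) (intro add_mono, simp_all add: Cons.IH)
  then show ?case by simp
qed simp

lemma poly_deriv_op_nonzero:
  assumes "\<forall>\<eta>\<in>set etas. Im \<eta> \<ge> 0" and "\<And>s. Im s < 0 \<Longrightarrow> poly g s \<noteq> 0" and "Im s < 0"
  shows "poly (poly_deriv_op (length etas) (\<Prod>\<eta>\<leftarrow>etas. [:1, -\<eta>:]) g) s \<noteq> 0"
  using assms
proof (induction etas arbitrary: g)
  case Nil
  then show ?case by (simp add: poly_deriv_op_def)
next
  case (Cons \<eta> etas)
  have eq: "poly_deriv_op (length (\<eta>#etas)) (\<Prod>\<eta>\<leftarrow>\<eta>#etas. [:1, -\<eta>:]) g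
      = poly_deriv_op (length etas) (\<Prod>\<eta>\<leftarrow>etas. [:1, -\<eta>:]) (g - smult \<eta> (pderiv g))"
    using poly_deriv_op_mult[OF degree_prod_linear_le] by (simp del: mult_pCons_left)
  show ?case unfolding eq
    using Cons.prems by (intro Cons.IH poly_minus_pderiv_nonzero) auto
qed

section \<open>The falling factorial multiplier in one variable\<close>

definition falling :: "nat \<Rightarrow> nat \<Rightarrow> nat" where
  "falling b l = (if l \<le> b then fact b div fact (b - l) else 0)"

lemma falling_pochhammer: "l \<le> b \<Longrightarrow> falling b l = pochhammer (Suc (b - l)) l"
proof -
  assume "l \<le> b"
  then have "fact b = fact (b - l) * pochhammer (Suc (b - l)) l"
    using pochhammer_product[of "b - l" b "1::nat"] by (simp add: pochhammer_fact)
  then show ?thesis using \<open>l \<le> b\<close> by (simp add: falling_def)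
qed

lemma higher_pderiv_monom_1:
  "(pderiv ^^ l) (Polynomial.monom 1 b) = Polynomial.monom (of_nat (falling b l) :: complex) (b - l)"
proof (rule poly_eqI)
  fix n
  show "coeff ((pderiv ^^ l) (Polynomial.monom 1 b)) n
      = coeff (Polynomial.monom (of_nat (falling b l) :: complex) (b - l)) n"
    using falling_pochhammer[of l b]
    by (auto simp: coeff_higher_pderiv falling_def pochhammer_of_nat[symmetric])
qed

text \<open>With \<open>s = 1/t\<close>, the multiplied polynomial is \<open>t\<^sup>b\<close> times \<open>q(d/ds) s\<^sup>b\<close>.\<close>
lemma falling_multiplier_univariate:
  fixes q :: "complex poly"
  assumes q0: "coeff q 0 \<noteq> 0" and q: "\<And>t. Im t > 0 \<Longrightarrow> poly q t \<noteq> 0" and t: "Im t > 0"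
  shows "(\<Sum>l\<le>b. of_nat (falling b l) * coeff q l * t ^ l) \<noteq> 0"
proof -
  obtain etas where e: "\<forall>\<eta>\<in>set etas. Im \<eta> \<ge> 0"
      and qe: "q = smult (coeff q 0) (\<Prod>\<eta>\<leftarrow>etas. [:1, -\<eta>:])"
    using stable_poly_factorization[OF q0 q] by auto
  define Q where "Q = (\<Prod>\<eta>\<leftarrow>etas. [:1, -\<eta>:])"
  define N where "N = length etas"
  have t0: "t \<noteq> 0" using t by auto
  have s: "Im (1/t) < 0"
    using t t0 by (simp add: Im_divide divide_neg_pos sum_power2_gt_zero_iff complex_eq_iff)
  have dQ: "degree Q \<le> N"
    unfolding Q_def N_def by (rule degree_prod_linear_le)
  \<comment> \<open>The power s^b vanishes at most at 0, which lies outside the open lower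
    half-plane, whereas 1/t lies inside.\<close>
  have "poly (poly_deriv_op N Q (Polynomial.monom 1 b)) (1/t) \<noteq> 0"
    unfolding Q_def N_def using e s
    by (intro poly_deriv_op_nonzero) (auto simp: poly_monom)
  moreover have "t ^ b * poly (poly_deriv_op N Q (Polynomial.monom 1 b)) (1/t)
      = (\<Sum>l\<le>N. of_nat (falling b l) * coeff Q l * t ^ l)"
    unfolding poly_deriv_op_def poly_sum sum_distrib_left
  proof (intro sum.cong refl)
    fix l
    show "t ^ b * poly (smult (coeff Q l) ((pderiv ^^ l) (Polynomial.monom 1 b))) (1/t)
      = of_nat (falling b l) * coeff Q l * t ^ l"
    proof (cases "l \<le> b")
      case True
      have "t ^ b = t ^ (b - l) * t ^ l" using True by (simp flip: power_add)
      then show ?thesis using True t0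
        by (simp add: higher_pderiv_monom_1 poly_monom power_one_over)
    next
      case False
      then show ?thesis by (simp add: higher_pderiv_monom_1 falling_def)
    qed
  qed
  \<comment> \<open>Beyond \<open>b\<close> the falling factorial is 0, and beyond \<open>N\<close>
    the coefficient is 0.\<close>
  moreover have "(\<Sum>l\<le>N. of_nat (falling b l) * coeff Q l * t ^ l)
     = (\<Sum>l\<le>b. of_nat (falling b l) * coeff Q l * t ^ l)"
    using dQ by (intro sum.mono_neutral_cong) (auto simp: falling_def coeff_eq_0)
  ultimately have "(\<Sum>l\<le>b. of_nat (falling b l) * coeff Q l * t ^ l) \<noteq> 0"
    using t0 by auto
  moreover have "(\<Sum>l\<le>b. of_nat (falling b l) * coeff q l * t ^ l)
     = coeff q 0 * (\<Sum>l\<le>b. of_nat (falling b l) * coeff Q l * t ^ l)"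
    by (subst (1) qe) (simp add: Q_def sum_distrib_left algebra_simps)
  ultimately show ?thesis using q0 by simp
qed

section \<open>Szasz's inequality\<close>

lemma coeffs_prod_linear:
  fixes etas :: "complex list"
  defines "Q \<equiv> \<Prod>\<eta>\<leftarrow>etas. [:1, -\<eta>:]"
  shows "coeff Q 0 = 1" and "coeff Q 1 = - sum_list etas"
    and "2 * coeff Q 2 = (sum_list etas)\<^sup>2 - (\<Sum>\<eta>\<leftarrow>etas. \<eta>\<^sup>2)"
proof -
  have "coeff Q 0 = 1 \<and> coeff Q 1 = - sum_list etas \<and>
      2 * coeff Q 2 = (sum_list etas)\<^sup>2 - (\<Sum>\<eta>\<leftarrow>etas. \<eta>\<^sup>2)"
    unfolding Q_def
  proof (induction etas)
    case Nil
    then show ?case by simp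
  next
    case (Cons \<eta> etas)
    then show ?case by (simp add: numeral_2_eq_2) (simp add: power2_eq_square algebra_simps)
  qed
  then show "coeff Q 0 = 1" "coeff Q 1 = - sum_list etas"
    "2 * coeff Q 2 = (sum_list etas)\<^sup>2 - (\<Sum>\<eta>\<leftarrow>etas. \<eta>\<^sup>2)" by auto
qed

text \<open>The linear term keeps its sign. Over all factors it adds up to the real part of t times
  the sum of the \<eta>, which a single coefficient controls; the sum of the |\<eta>| would not be
  controlled.\<close>

lemma norm_one_minus_le: "cmod (1 - u) \<le> exp (- Re u + (cmod u)\<^sup>2 / 2)"
proof -
  have "(cmod (1 - u))\<^sup>2 = 1 + (- 2 * Re u + (cmod u)\<^sup>2)"
    unfolding cmod_power2 by (simp add: power2_eq_square algebra_simps)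
  also have "\<dots> \<le> exp (- 2 * Re u + (cmod u)\<^sup>2)" by (rule exp_ge_add_one_self)
  also have "\<dots> = (exp (- Re u + (cmod u)\<^sup>2 / 2))\<^sup>2"
    using exp_double[of "- Re u + (cmod u)\<^sup>2 / 2"] by (simp add: algebra_simps)
  finally show ?thesis by (rule power2_le_imp_le) simp
qed

lemma norm_poly_prod_linear_le:
  "cmod (poly (\<Prod>\<eta>\<leftarrow>etas. [:1, -\<eta>:]) t)
    \<le> exp (- Re (t * sum_list etas) + (cmod t)\<^sup>2 / 2 * (\<Sum>\<eta>\<leftarrow>etas. (cmod \<eta>)\<^sup>2))"
proof (induction etas)
  case Nil
  then show ?case by simp
next
  case (Cons \<eta> etas)
  have "cmod (poly (\<Prod>\<eta>\<leftarrow>\<eta>#etas. [:1, -\<eta>:]) t)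
      = cmod (1 - t * \<eta>) * cmod (poly (\<Prod>\<eta>\<leftarrow>etas. [:1, -\<eta>:]) t)"
    by (simp flip: norm_mult) (simp add: algebra_simps)
  also have "\<dots> \<le> exp (- Re (t * \<eta>) + (cmod (t * \<eta>))\<^sup>2 / 2) *
      exp (- Re (t * sum_list etas) + (cmod t)\<^sup>2 / 2 * (\<Sum>\<eta>\<leftarrow>etas. (cmod \<eta>)\<^sup>2))"
    by (intro mult_mono norm_one_minus_le Cons.IH) auto
  also have "\<dots> = exp (- Re (t * sum_list (\<eta>#etas)) + (cmod t)\<^sup>2 / 2 * (\<Sum>\<eta>\<leftarrow>\<eta>#etas. (cmod \<eta>)\<^sup>2))"
    by (simp add: norm_mult power_mult_distrib algebra_simps flip: exp_add)
  finally show ?case .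
qed

text \<open>Here the location of the roots enters. One has |\<eta>|^2 = Re (\<eta>^2) + 2 (Im
  \<eta>)^2, and as all Im \<eta> are nonnegative, the sum of their squares is at most the square of
  their sum.\<close>

lemma sum_list_power2_norm_le:
  assumes "\<forall>\<eta>\<in>set etas. Im \<eta> \<ge> 0"
  shows "(\<Sum>\<eta>\<leftarrow>etas. (cmod \<eta>)\<^sup>2) \<le> cmod (\<Sum>\<eta>\<leftarrow>etas. \<eta>\<^sup>2) + 2 * (cmod (sum_list etas))\<^sup>2"
proof -
  have "Im (sum_list etas) \<ge> 0 \<and>
      (\<Sum>\<eta>\<leftarrow>etas. (cmod \<eta>)\<^sup>2) \<le> Re (\<Sum>\<eta>\<leftarrow>etas. \<eta>\<^sup>2) + 2 * (Im (sum_list etas))\<^sup>2"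
    using assms
  proof (induction etas)
    case (Cons \<eta> etas)
    then have IH: "Im (sum_list etas) \<ge> 0"
        "(\<Sum>\<eta>\<leftarrow>etas. (cmod \<eta>)\<^sup>2) \<le> Re (\<Sum>\<eta>\<leftarrow>etas. \<eta>\<^sup>2) + 2 * (Im (sum_list etas))\<^sup>2"
      and im: "Im \<eta> \<ge> 0" by auto
    have "Im \<eta> * Im (sum_list etas) \<ge> 0" using im IH(1) by simp
    moreover have "(cmod \<eta>)\<^sup>2 = Re (\<eta>\<^sup>2) + 2 * (Im \<eta>)\<^sup>2"
      unfolding cmod_power2 by (simp add: power2_eq_square)
    moreover have "(Im (sum_list (\<eta> # etas)))\<^sup>2
        = (Im \<eta>)\<^sup>2 + (Im (sum_list etas))\<^sup>2 + 2 * (Im \<eta> * Im (sum_list etas))"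
      by (simp add: power2_sum)
    ultimately have "(\<Sum>\<eta>\<leftarrow>\<eta>#etas. (cmod \<eta>)\<^sup>2)
        \<le> Re (\<Sum>\<eta>\<leftarrow>\<eta>#etas. \<eta>\<^sup>2) + 2 * (Im (sum_list (\<eta> # etas)))\<^sup>2"
      using IH(2) unfolding list.map sum_list.Cons plus_complex.sel by linarith
    then show ?case using IH(1) im by simp
  qed simp
  moreover have "Re (\<Sum>\<eta>\<leftarrow>etas. \<eta>\<^sup>2) \<le> cmod (\<Sum>\<eta>\<leftarrow>etas. \<eta>\<^sup>2)" by (rule complex_Re_le_cmod)
  moreover have "(Im (sum_list etas))\<^sup>2 \<le> (cmod (sum_list etas))\<^sup>2" by (simp add: cmod_power2)
  ultimately show ?thesis by linarith
qed

text \<open>The reciprocals \<eta> of the roots have sum -a1/a0, and their squares have sum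
  (a1/a0)^2 - 2 a2/a0. The previous lemma bounds the sum of the |\<eta>|^2 by |(a1/a0)^2 - 2 a2/a0|
  + 2 |a1/a0|^2, whence the 3 and the 2.\<close>

definition szasz_exponent :: "complex \<Rightarrow> complex \<Rightarrow> complex \<Rightarrow> real \<Rightarrow> real" where
  "szasz_exponent a0 a1 a2 R
    = R * cmod (a1 / a0) + R\<^sup>2 / 2 * (3 * (cmod (a1 / a0))\<^sup>2 + 2 * cmod (a2 / a0))"

lemma szasz_bound:
  fixes p :: "complex poly"
  assumes p0: "coeff p 0 \<noteq> 0" and p: "\<And>t. Im t > 0 \<Longrightarrow> poly p t \<noteq> 0"
  shows "cmod (poly p t) \<le> cmod (coeff p 0) *
    exp (szasz_exponent (coeff p 0) (coeff p 1) (coeff p 2) (cmod t))"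
proof -
  obtain etas where e: "\<forall>\<eta>\<in>set etas. Im \<eta> \<ge> 0"
      and pe: "p = smult (coeff p 0) (\<Prod>\<eta>\<leftarrow>etas. [:1, -\<eta>:])"
    using stable_poly_factorization[OF p0 p] by auto
  define Q where "Q = (\<Prod>\<eta>\<leftarrow>etas. [:1, -\<eta>:])"
  have c: "coeff p n / coeff p 0 = coeff Q n" for n
    using p0 by (subst pe) (simp add: Q_def)
  let ?e1 = "cmod (coeff Q 1)" and ?e2 = "cmod (coeff Q 2)"
  have s1: "cmod (sum_list etas) = ?e1" unfolding Q_def coeffs_prod_linear by simp
  have "(\<Sum>\<eta>\<leftarrow>etas. \<eta>\<^sup>2) = (sum_list etas)\<^sup>2 - 2 * coeff Q 2"
    unfolding Q_def coeffs_prod_linear by simp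
  then have "cmod (\<Sum>\<eta>\<leftarrow>etas. \<eta>\<^sup>2) \<le> ?e1\<^sup>2 + 2 * ?e2"
    by (metis norm_triangle_ineq4 norm_power s1 norm_mult norm_numeral)
  then have s2: "(\<Sum>\<eta>\<leftarrow>etas. (cmod \<eta>)\<^sup>2) \<le> 3 * ?e1\<^sup>2 + 2 * ?e2"
    using sum_list_power2_norm_le[OF e] unfolding s1 by linarith
  have "- Re (t * sum_list etas) \<le> cmod (t * sum_list etas)"
    by (metis complex_Re_le_cmod norm_minus_cancel uminus_complex.sel(1))
  then have "- Re (t * sum_list etas) \<le> cmod t * ?e1" by (simp add: norm_mult s1)
  moreover have "(cmod t)\<^sup>2 / 2 * (\<Sum>\<eta>\<leftarrow>etas. (cmod \<eta>)\<^sup>2) \<le> (cmod t)\<^sup>2 / 2 * (3 * ?e1\<^sup>2 + 2 * ?e2)"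
    using s2 by (intro mult_left_mono) auto
  ultimately have "cmod (poly Q t) \<le> exp (cmod t * ?e1 + (cmod t)\<^sup>2 / 2 * (3 * ?e1\<^sup>2 + 2 * ?e2))"
    unfolding Q_def
    by (intro order_trans[OF norm_poly_prod_linear_le]) simp
  then have "cmod (poly Q t) \<le> exp (szasz_exponent (coeff p 0) (coeff p 1) (coeff p 2) (cmod t))"
    unfolding szasz_exponent_def c .
  moreover have "poly p t = coeff p 0 * poly Q t" by (subst pe) (simp add: Q_def)
  ultimately show ?thesis by (simp add: norm_mult mult_left_mono)
qed

lemma poly_coeff_Cauchy_bound:
  fixes p :: "complex poly"
  assumes "R > 0" and "\<And>t. cmod t = R \<Longrightarrow> cmod (poly p t) \<le> B"
  shows "cmod (coeff p n) * R ^ n \<le> B"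
proof -
  have d: "(deriv ^^ n) (poly p) = poly ((pderiv ^^ n) p)"
    by (induction n) (auto intro!: ext DERIV_imp_deriv poly_DERIV)
  have "poly ((pderiv ^^ n) p) 0 = fact n * coeff p n"
    by (simp add: poly_0_coeff_0 coeff_higher_pderiv pochhammer_fact)
  moreover have "cmod ((deriv ^^ n) (poly p) 0) \<le> fact n * B / R ^ n"
    using assms by (intro Cauchy_inequality) (auto intro!: holomorphic_intros continuous_intros)
  ultimately show ?thesis using assms(1) by (simp add: d norm_mult field_simps)
qed

lemma szasz_coeff_bound:
  fixes p :: "complex poly"
  assumes "coeff p 0 \<noteq> 0" and "\<And>t. Im t > 0 \<Longrightarrow> poly p t \<noteq> 0" and "R > 0"
  shows "cmod (coeff p n) * R ^ n
    \<le> cmod (coeff p 0) * exp (szasz_exponent (coeff p 0) (coeff p 1) (coeff p 2) R)"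
  using szasz_bound[OF assms(1,2)] by (intro poly_coeff_Cauchy_bound assms) auto

section \<open>Multivariate power series\<close>

definition tdeg :: "('v::finite \<Rightarrow> nat) \<Rightarrow> nat" where
  "tdeg \<alpha> = (\<Sum>i\<in>UNIV. \<alpha> i)"

definition upper_halfspace :: "(complex ^ 'v::finite) set" where
  "upper_halfspace = {x. \<forall>i. Im (x $ i) > 0}"

text \<open>Nonvanishing alone can be lost in a limit, as for the constants 1/k; by Hurwitz's
  theorem this alternative persists.\<close>

definition stable_or_zero :: "(complex ^ 'v::finite \<Rightarrow> complex) \<Rightarrow> bool" where
  "stable_or_zero f \<longleftrightarrow>
    (\<forall>x\<in>upper_halfspace. f x \<noteq> 0) \<or> (\<forall>x\<in>upper_halfspace. f x = 0)"

definition power_series :: "(('v::finite \<Rightarrow> nat) \<Rightarrow> complex) \<Rightarrow> complex ^ 'v \<Rightarrow> complex" where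
  "power_series c x = (\<Sum>\<^sub>\<infinity>\<alpha>. c \<alpha> * Defs.monom \<alpha> x)"

text \<open>Absolute convergence on all polydiscs. It holds exactly when
  \<open>has_coeffs f c\<close> for some \<open>f\<close>, and then \<open>f\<close> is
  \<open>power_series c\<close>.\<close>

definition entire_coeffs :: "(('v::finite \<Rightarrow> nat) \<Rightarrow> complex) \<Rightarrow> bool" where
  "entire_coeffs c \<longleftrightarrow> (\<forall>\<rho>\<ge>0. (\<lambda>\<alpha>. cmod (c \<alpha>) * \<rho> ^ tdeg \<alpha>) summable_on UNIV)"

lemma monom_vector_scale: "Defs.monom \<alpha> (t *s x) = t ^ tdeg \<alpha> * Defs.monom \<alpha> x"
  by (simp add: Defs.monom_def tdeg_def power_mult_distrib prod.distrib power_sum)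

lemma norm_monom_le:
  fixes x :: "complex ^ 'v::finite"
  assumes "\<And>i. cmod (x $ i) \<le> \<rho>"
  shows "cmod (Defs.monom \<alpha> x) \<le> \<rho> ^ tdeg \<alpha>"
  unfolding Defs.monom_def tdeg_def power_sum prod_norm[symmetric] norm_power
  using assms by (intro prod_mono) (auto intro: power_mono)

lemma continuous_on_monom [continuous_intros]: "continuous_on S (Defs.monom \<alpha>)"
  unfolding Defs.monom_def by (intro continuous_intros)

lemma holomorphic_monom_line: "(\<lambda>t. Defs.monom \<alpha> (x + t *s y)) holomorphic_on S"
  unfolding Defs.monom_def by (simp, intro holomorphic_intros)

lemma power_series_finite:
  assumes "finite A" and "\<And>\<alpha>. c \<alpha> \<noteq> 0 \<Longrightarrow> \<alpha> \<in> A"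
  shows "power_series c x = (\<Sum>\<alpha>\<in>A. c \<alpha> * Defs.monom \<alpha> x)"
proof -
  have "power_series c x = infsum (\<lambda>\<alpha>. c \<alpha> * Defs.monom \<alpha> x) A"
    unfolding power_series_def using assms(2) by (intro infsum_cong_neutral) auto
  then show ?thesis using assms(1) by simp
qed

lemma finite_bounded_multiindices: "finite {\<alpha> :: 'v::finite \<Rightarrow> nat. \<forall>i. \<alpha> i \<le> N i}"
proof -
  have "{\<alpha> :: 'v \<Rightarrow> nat. \<forall>i. \<alpha> i \<le> N i} = PiE UNIV (\<lambda>i. {..N i})"
    by (auto simp: PiE_def Pi_def extensional_def)
  then show ?thesis by (simp add: finite_PiE)
qed

lemma le_tdeg: "\<alpha> i \<le> tdeg \<alpha>"
  unfolding tdeg_def by (rule member_le_sum) auto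

lemma finite_tdeg_le: "finite {\<alpha> :: 'v::finite \<Rightarrow> nat. tdeg \<alpha> \<le> d}"
  by (rule finite_subset[OF _ finite_bounded_multiindices[of "\<lambda>_. d"]])
     (auto intro: order_trans[OF le_tdeg])

lemma finite_tdeg_eq: "finite {\<alpha> :: 'v::finite \<Rightarrow> nat. tdeg \<alpha> = d}"
  by (rule finite_subset[OF _ finite_tdeg_le[of d]]) auto

text \<open>A finite set of multi-indices fits into a box, and the sum over a box factors into
  geometric sums, each at most 1/(1 - q).\<close>

lemma summable_on_power_tdeg:
  fixes q :: real
  assumes "0 \<le> q" "q < 1"
  shows "(\<lambda>\<alpha> :: 'v::finite \<Rightarrow> nat. q ^ tdeg \<alpha>) summable_on UNIV"
proof (rule nonneg_bdd_above_summable_on)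
  show "bdd_above (sum (\<lambda>\<alpha> :: 'v \<Rightarrow> nat. q ^ tdeg \<alpha>) ` {F. F \<subseteq> UNIV \<and> finite F})"
  proof (rule bdd_aboveI2)
    fix F :: "('v \<Rightarrow> nat) set"
    assume "F \<in> {F. F \<subseteq> UNIV \<and> finite F}"
    then have F: "finite F" by simp
    define N where "N = Max (insert 0 (tdeg ` F))"
    have "F \<subseteq> PiE UNIV (\<lambda>_. {..N})"
    proof
      fix \<alpha> assume "\<alpha> \<in> F"
      then have "tdeg \<alpha> \<le> N" using F by (auto simp: N_def)
      then show "\<alpha> \<in> PiE UNIV (\<lambda>_. {..N})" by (auto intro: order_trans[OF le_tdeg])
    qed
    then have "(\<Sum>\<alpha>\<in>F. q ^ tdeg \<alpha>) \<le> (\<Sum>\<alpha>\<in>PiE (UNIV :: 'v set) (\<lambda>_. {..N}). q ^ tdeg \<alpha>)"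
      using assms by (intro sum_mono2) (auto intro: finite_PiE)
    also have "\<dots> = (\<Prod>i\<in>(UNIV :: 'v set). \<Sum>n\<le>N. q ^ n)"
      by (subst prod_sum_PiE) (auto simp: tdeg_def power_sum)
    also have "\<dots> \<le> (\<Prod>i\<in>(UNIV :: 'v set). 1 / (1 - q))"
    proof (intro prod_mono conjI)
      have "(\<Sum>n\<le>N. q ^ n) = (1 - q ^ Suc N) / (1 - q)"
        using assms by (simp add: sum_gp0)
      also have "\<dots> \<le> 1 / (1 - q)" using assms by (intro divide_right_mono) auto
      finally show "(\<Sum>n\<le>N. q ^ n) \<le> 1 / (1 - q)" .
    qed (use assms in \<open>auto intro: sum_nonneg\<close>)
    finally show "(\<Sum>\<alpha>\<in>F. q ^ tdeg \<alpha>) \<le> (\<Prod>i\<in>(UNIV :: 'v set). 1 / (1 - q))" .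
  qed
qed (use assms in auto)

section \<open>Entire series and Cauchy estimates for their coefficients\<close>

lemma summable_on_power_series:
  assumes "entire_coeffs c"
  shows "(\<lambda>\<alpha>. c \<alpha> * Defs.monom \<alpha> x) summable_on UNIV"
proof -
  define \<rho> where "\<rho> = norm x"
  have "(\<lambda>\<alpha>. cmod (c \<alpha>) * \<rho> ^ tdeg \<alpha>) summable_on UNIV"
    using assms by (auto simp: entire_coeffs_def \<rho>_def)
  then have "(\<lambda>\<alpha>. norm (c \<alpha> * Defs.monom \<alpha> x)) summable_on UNIV"
    by (rule summable_on_comparison_test)
       (auto simp: norm_mult \<rho>_def intro!: mult_left_mono norm_monom_le Finite_Cartesian_Product.norm_nth_le)
  then show ?thesis by (rule abs_summable_summable)
qed

lemma entire_coeffs_has_coeffs: "entire_coeffs c \<Longrightarrow> has_coeffs (power_series c) c"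
  unfolding has_coeffs_def power_series_def
  by (intro allI has_sum_infsum summable_on_power_series)

text \<open>For complex families unordered summability is absolute, so the point with all
  coordinates equal to \<rho> already yields the weighted sum of moduli.\<close>

lemma has_coeffs_imp_entire:
  assumes "has_coeffs f c"
  shows "entire_coeffs c" and "f = power_series c"
proof -
  show "f = power_series c"
    using assms by (auto simp: has_coeffs_def power_series_def fun_eq_iff intro!: infsumI[symmetric])
  show "entire_coeffs c"
    unfolding entire_coeffs_def
  proof (intro allI impI)
    fix \<rho> :: real assume "\<rho> \<ge> 0"
    have "(\<lambda>\<alpha>. c \<alpha> * Defs.monom \<alpha> (\<chi> i. of_real \<rho>)) summable_on UNIV"
      using assms by (auto simp: has_coeffs_def summable_on_def)
    then have "(\<lambda>\<alpha>. norm (c \<alpha> * Defs.monom \<alpha> (\<chi> i. of_real \<rho>))) summable_on UNIV"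
      by (simp add: summable_on_iff_abs_summable_on_complex)
    then show "(\<lambda>\<alpha>. cmod (c \<alpha>) * \<rho> ^ tdeg \<alpha>) summable_on UNIV"
      using \<open>\<rho> \<ge> 0\<close>
      by (simp add: norm_mult Defs.monom_def tdeg_def power_sum prod_norm[symmetric] norm_power)
  qed
qed

lemma entire_coeffs_finite: "finite {\<alpha>. c \<alpha> \<noteq> 0} \<Longrightarrow> entire_coeffs c"
  unfolding entire_coeffs_def
  by (auto intro!: finite_nonzero_values_imp_summable_on elim: finite_subset[rotated])

text \<open>These weights make the Kronecker substitution \<open>x\<^sub>i = t ^ w i\<close> lossless.\<close>
lemma injective_weights:
  fixes A :: "('v::finite \<Rightarrow> nat) set"
  assumes "finite A"
  shows "\<exists>w :: 'v \<Rightarrow> nat. inj_on (\<lambda>\<alpha>. \<Sum>i\<in>UNIV. \<alpha> i * w i) A"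
proof -
  have "\<exists>w :: 'v \<Rightarrow> nat. \<forall>\<alpha>\<in>A. \<forall>\<beta>\<in>A. (\<Sum>i\<in>I. \<alpha> i * w i) = (\<Sum>i\<in>I. \<beta> i * w i)
      \<longrightarrow> (\<forall>i\<in>I. \<alpha> i = \<beta> i)" for I :: "'v set"
  proof (induction I rule: finite_induct[OF finite])
    case 1
    then show ?case by simp
  next
    case (2 j I)
    then obtain w where w: "\<And>\<alpha> \<beta>. \<lbrakk>\<alpha> \<in> A; \<beta> \<in> A; (\<Sum>i\<in>I. \<alpha> i * w i) = (\<Sum>i\<in>I. \<beta> i * w i)\<rbrakk>
      \<Longrightarrow> \<forall>i\<in>I. \<alpha> i = \<beta> i" by blast
    \<comment> \<open>\<open>B\<close> exceeds all old sums over \<open>I\<close>, so division by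
      \<open>B\<close> reads off the new exponent like a leading digit.\<close>
    define B where "B = Suc (Max (insert 0 ((\<lambda>\<alpha>. \<Sum>i\<in>I. \<alpha> i * w i) ` A)))"
    have B: "(\<Sum>i\<in>I. \<alpha> i * w i) < B" if "\<alpha> \<in> A" for \<alpha>
      unfolding B_def using assms that by (simp add: less_Suc_eq_le)
    have eq: "(\<Sum>i\<in>insert j I. \<alpha> i * (w(j := B)) i) = \<alpha> j * B + (\<Sum>i\<in>I. \<alpha> i * w i)" for \<alpha>
    proof -
      have "(\<Sum>i\<in>I. \<alpha> i * (w(j := B)) i) = (\<Sum>i\<in>I. \<alpha> i * w i)"
        using 2 by (intro sum.cong) auto
      then show ?thesis using 2 by simp
    qed
    show ?case
    proof (rule exI[of _ "w(j := B)"], intro ballI impI)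
      fix \<alpha> \<beta> i
      assume \<alpha>: "\<alpha> \<in> A" and \<beta>: "\<beta> \<in> A" and i: "i \<in> insert j I"
        and *: "(\<Sum>i\<in>insert j I. \<alpha> i * (w(j := B)) i) = (\<Sum>i\<in>insert j I. \<beta> i * (w(j := B)) i)"
      from *[unfolded eq]
      have "(\<alpha> j * B + (\<Sum>i\<in>I. \<alpha> i * w i)) div B = (\<beta> j * B + (\<Sum>i\<in>I. \<beta> i * w i)) div B"
        by simp
      then have "\<alpha> j = \<beta> j"
        using B[OF \<alpha>] B[OF \<beta>] by (simp add: div_mult_self3)
      moreover from this *[unfolded eq] have "\<forall>i\<in>I. \<alpha> i = \<beta> i"
        using w[OF \<alpha> \<beta>] by simp
      ultimately show "\<alpha> i = \<beta> i" using i by auto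
    qed
  qed
  then obtain w :: "'v \<Rightarrow> nat" where "\<forall>\<alpha>\<in>A. \<forall>\<beta>\<in>A. (\<Sum>i\<in>UNIV. \<alpha> i * w i) = (\<Sum>i\<in>UNIV. \<beta> i * w i)
      \<longrightarrow> (\<forall>i\<in>UNIV. \<alpha> i = \<beta> i)" by blast
  then show ?thesis by (intro exI[of _ w]) (auto simp: inj_on_def)
qed

text \<open>The substitution x_i = R t^(w i) maps the unit circle into the torus |x_i| = R. It gives
  a univariate polynomial in which distinct \<alpha> occupy distinct powers of t, so the univariate
  Cauchy estimate applies to each coefficient.\<close>

lemma Cauchy_bound_finite:
  fixes c :: "('v::finite \<Rightarrow> nat) \<Rightarrow> complex"
  assumes A: "finite A" and R: "R > 0" and \<alpha>: "\<alpha> \<in> A"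
    and M: "\<And>x :: complex ^ 'v. (\<And>i. cmod (x $ i) = R) \<Longrightarrow> cmod (\<Sum>\<alpha>\<in>A. c \<alpha> * Defs.monom \<alpha> x) \<le> M"
  shows "cmod (c \<alpha>) * R ^ tdeg \<alpha> \<le> M"
proof -
  obtain w :: "'v \<Rightarrow> nat" where w: "inj_on (\<lambda>\<alpha>. \<Sum>i\<in>UNIV. \<alpha> i * w i) A"
    using injective_weights[OF A] by blast
  define W where "W = (\<lambda>\<alpha>. \<Sum>i\<in>UNIV. \<alpha> i * w i)"
  define p where "p = (\<Sum>\<alpha>\<in>A. Polynomial.monom (c \<alpha> * of_real R ^ tdeg \<alpha>) (W \<alpha>))"
  have "coeff p (W \<alpha>) = (\<Sum>\<beta>\<in>A. if \<alpha> = \<beta> then c \<alpha> * of_real R ^ tdeg \<alpha> else 0)"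
    unfolding p_def coeff_sum using w \<alpha> by (intro sum.cong) (auto simp: inj_on_def W_def)
  then have cp: "coeff p (W \<alpha>) = c \<alpha> * of_real R ^ tdeg \<alpha>" using A \<alpha> by simp
  have "cmod (poly p t) \<le> M" if "cmod t = 1" for t
  proof -
    have "poly p t = (\<Sum>\<alpha>\<in>A. c \<alpha> * Defs.monom \<alpha> (\<chi> i. of_real R * t ^ w i))"
      unfolding p_def poly_sum
      by (intro sum.cong refl)
         (simp add: poly_monom Defs.monom_def W_def tdeg_def power_mult_distrib power_sum
            prod.distrib mult.commute flip: power_mult)
    then show ?thesis using R that by (simp add: M norm_mult norm_power)
  qed
  from poly_coeff_Cauchy_bound[of 1 p M "W \<alpha>", OF _ this] show ?thesis
    using R by (simp add: cp norm_mult norm_power)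
qed

text \<open>Outside a suitable finite set containing \<alpha> the series contributes at most
  \<open>e\<close> on the whole torus, so the finite case applies with \<open>M + e\<close>.\<close>

lemma Cauchy_bound:
  fixes c :: "('v::finite \<Rightarrow> nat) \<Rightarrow> complex"
  assumes c: "entire_coeffs c" and R: "R > 0"
    and M: "\<And>x :: complex ^ 'v. (\<And>i. cmod (x $ i) = R) \<Longrightarrow> cmod (power_series c x) \<le> M"
  shows "cmod (c \<alpha>) * R ^ tdeg \<alpha> \<le> M"
proof (rule field_le_epsilon)
  fix e :: real assume e: "e > 0"
  let ?g = "\<lambda>\<alpha>. cmod (c \<alpha>) * R ^ tdeg \<alpha>"
  have sg: "?g summable_on UNIV" using c R by (auto simp: entire_coeffs_def)
  obtain A0 where A0: "finite A0" "dist (sum ?g A0) (infsum ?g UNIV) \<le> e"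
    using infsum_finite_approximation[OF sg e] by auto
  define A where "A = insert \<alpha> A0"
  have A: "finite A" using A0 by (simp add: A_def)
  have sgc: "?g summable_on (- A)" using sg by (rule summable_on_subset_banach) auto
  have "infsum ?g (- A) = infsum ?g UNIV - sum ?g A"
    using infsum_Diff[of ?g UNIV A] sg A by (simp add: Compl_eq_Diff_UNIV)
  also have "\<dots> \<le> infsum ?g UNIV - sum ?g A0"
    using A R by (intro diff_left_mono sum_mono2) (auto simp: A_def)
  also have "\<dots> \<le> e" using A0(2) by (simp add: dist_real_def)
  finally have tail: "infsum ?g (- A) \<le> e" .
  show "cmod (c \<alpha>) * R ^ tdeg \<alpha> \<le> M + e"
  proof (rule Cauchy_bound_finite[OF A R])
    show "\<alpha> \<in> A" by (simp add: A_def)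
    fix x :: "complex ^ 'v" assume x: "\<And>i. cmod (x $ i) = R"
    have sm: "(\<lambda>\<alpha>. c \<alpha> * Defs.monom \<alpha> x) summable_on UNIV" by (rule summable_on_power_series[OF c])
    have "(\<Sum>\<alpha>\<in>A. c \<alpha> * Defs.monom \<alpha> x)
        = power_series c x - infsum (\<lambda>\<alpha>. c \<alpha> * Defs.monom \<alpha> x) (- A)"
      using infsum_Diff[of "\<lambda>\<alpha>. c \<alpha> * Defs.monom \<alpha> x" UNIV A] sm A
      by (simp add: Compl_eq_Diff_UNIV power_series_def)
    also have "cmod \<dots> \<le> cmod (power_series c x) + cmod (infsum (\<lambda>\<alpha>. c \<alpha> * Defs.monom \<alpha> x) (- A))"
      by (rule norm_triangle_ineq4)
    also have "cmod (infsum (\<lambda>\<alpha>. c \<alpha> * Defs.monom \<alpha> x) (- A)) \<le> infsum ?g (- A)"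
      using sgc x by (intro norm_infsum_le[OF has_sum_infsum has_sum_infsum])
        (auto simp: norm_mult intro!: mult_left_mono norm_monom_le summable_on_subset_banach[OF sm])
    finally show "cmod (\<Sum>\<alpha>\<in>A. c \<alpha> * Defs.monom \<alpha> x) \<le> M + e"
      using M[OF x] tail by linarith
  qed
qed

section \<open>Limits of stable functions\<close>

lemma open_convex_line_upper_halfspace:
  fixes x y :: "complex ^ 'v::finite"
  shows "open {t. x + t *s y \<in> upper_halfspace}" and "convex {t. x + t *s y \<in> upper_halfspace}"
proof -
  have eq: "{t. x + t *s y \<in> upper_halfspace} = (\<Inter>i. {t. Im (x $ i + t * y $ i) > 0})"
    by (auto simp: upper_halfspace_def)
  show "open {t. x + t *s y \<in> upper_halfspace}"
    unfolding eq by (intro open_INT finite ballI open_Collect_less continuous_intros)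
  show "convex {t. x + t *s y \<in> upper_halfspace}"
    unfolding eq
  proof (intro convex_INT convexI)
    fix i s t and u v :: real
    assume st: "s \<in> {t. Im (x $ i + t * y $ i) > 0}" "t \<in> {t. Im (x $ i + t * y $ i) > 0}"
      and uv: "0 \<le> u" "0 \<le> v" "u + v = 1"
    have "Im (x $ i + (u *\<^sub>R s + v *\<^sub>R t) * y $ i)
        = u * Im (x $ i + s * y $ i) + v * Im (x $ i + t * y $ i)"
    proof -
      have "x $ i = u *\<^sub>R x $ i + v *\<^sub>R x $ i" using uv by (simp flip: scaleR_add_left)
      then have "x $ i + (u *\<^sub>R s + v *\<^sub>R t) * y $ i
          = u *\<^sub>R (x $ i + s * y $ i) + v *\<^sub>R (x $ i + t * y $ i)"
        by (simp add: algebra_simps)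
      then show ?thesis by simp
    qed
    also have "\<dots> > 0"
    proof (cases "u = 0")
      case False
      then show ?thesis using st uv by (intro add_pos_nonneg mult_pos_pos mult_nonneg_nonneg) auto
    qed (use st uv in auto)
    finally show "u *\<^sub>R s + v *\<^sub>R t \<in> {t. Im (x $ i + t * y $ i) > 0}" by simp
  qed
qed

text \<open>Hurwitz's theorem, applied on complex lines.\<close>
lemma stable_or_zero_limit:
  fixes F :: "nat \<Rightarrow> complex ^ 'v::finite \<Rightarrow> complex"
  assumes lim: "\<And>S. compact S \<Longrightarrow> uniform_limit S F f sequentially"
    and hol: "\<And>n x y. (\<lambda>t. F n (x + t *s y)) holomorphic_on UNIV"
    and sz: "\<And>n. stable_or_zero (F n)"
  shows "stable_or_zero f"
proof (rule ccontr)
  assume "\<not> stable_or_zero f"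
  then obtain x y where x: "x \<in> upper_halfspace" "f x \<noteq> 0" and y: "y \<in> upper_halfspace" "f y = 0"
    by (auto simp: stable_or_zero_def)
  define l where "l = (\<lambda>t. x + t *s (y - x))"
  define U where "U = {t. x + t *s (y - x) \<in> upper_halfspace}"
  have U: "open U" "convex U"
    using open_convex_line_upper_halfspace[of x "y - x"] by (simp_all add: U_def)
  have "(\<lambda>n. F n x) \<longlonglongrightarrow> f x"
    using tendsto_uniform_limitI[OF lim[of "{x}"]] by simp
  then have "\<forall>\<^sub>F n in sequentially. F n x \<noteq> 0"
    using x(2) by (rule tendsto_imp_eventually_ne)
  \<comment> \<open>A nonzero value at \<open>x\<close> rules out the zero alternative, so from
    index \<open>N\<close> on \<open>F n\<close> has no zeros in the half-space. The sequence is
    shifted by \<open>N\<close> to have this for all its members.\<close>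
  then obtain N where N: "\<And>n. n \<ge> N \<Longrightarrow> F n x \<noteq> 0" by (auto simp: eventually_sequentially)
  have ul: "uniform_limit K (\<lambda>n t. F (n + N) (l t)) (\<lambda>t. f (l t)) sequentially" if "compact K" for K
  proof (rule uniform_limitI)
    fix e :: real assume "e > 0"
    have "continuous_on K l"
    proof -
      have "l = (\<lambda>t. \<chi> i. x $ i + t * (y $ i - x $ i))" by (simp add: l_def fun_eq_iff vec_eq_iff algebra_simps)
      then show ?thesis by (auto intro!: continuous_intros)
    qed
    then have "compact (l ` K)" using that by (rule compact_continuous_image)
    from uniform_limitD[OF lim[OF this] \<open>e > 0\<close>] obtain M
      where "\<And>n z. n \<ge> M \<Longrightarrow> z \<in> l ` K \<Longrightarrow> dist (F n z) (f z) < e"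
      by (auto simp: eventually_sequentially)
    then show "\<forall>\<^sub>F n in sequentially. \<forall>t\<in>K. dist (F (n + N) (l t)) (f (l t)) < e"
      by (auto simp: eventually_sequentially intro!: exI[of _ M])
  qed
  have hol': "(\<lambda>t. F n (l t)) holomorphic_on S" for n S
    unfolding l_def by (rule holomorphic_on_subset[OF hol]) auto
  have "(\<lambda>t. f (l t)) holomorphic_on U"
  proof (rule holomorphic_uniform_sequence[OF U(1) hol'])
    fix t assume "t \<in> U"
    then obtain d where "d > 0" "cball t d \<subseteq> U" using U(1) open_contains_cball by blast
    then show "\<exists>d>0. cball t d \<subseteq> U \<and> uniform_limit (cball t d) (\<lambda>n t. F (n + N) (l t)) (\<lambda>t. f (l t)) sequentially"
      by (intro exI[of _ d] conjI ul compact_cball)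
  qed
  moreover have "l 0 = x" "l 1 = y" by (simp_all add: l_def vec_eq_iff)
  moreover have "0 \<in> U" "1 \<in> U" using x y \<open>l 0 = x\<close> \<open>l 1 = y\<close> unfolding U_def l_def by simp_all
  moreover have "\<not> (\<lambda>t. f (l t)) constant_on U"
    using x y calculation unfolding constant_on_def by metis
  moreover have "F (n + N) (l t) \<noteq> 0" if "t \<in> U" for n t
    using sz[of "n + N"] N[of "n + N"] x(1) that
    by (auto simp: stable_or_zero_def U_def l_def)
  ultimately have "f (l 1) \<noteq> 0"
    using U ul hol'
    by (intro Hurwitz_no_zeros[of U "\<lambda>n t. F (n + N) (l t)" "\<lambda>t. f (l t)" 1])
       (auto intro: convex_connected)
  then show False using y \<open>l 1 = y\<close> by simp
qed

text \<open>The index map \<phi> may identify indices: for the falling multiplier the terms are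
  indexed by pairs (\<alpha>, l), and several pairs can yield the same monomial.\<close>

lemma stable_or_zero_limit_sum:
  fixes \<phi> :: "'a \<Rightarrow> 'v::finite \<Rightarrow> nat"
  assumes A: "finite A" and lim: "\<And>a. a \<in> A \<Longrightarrow> (\<lambda>n. \<kappa> n a) \<longlonglongrightarrow> \<kappa>' a"
    and sz: "\<And>n. stable_or_zero (\<lambda>x. \<Sum>a\<in>A. \<kappa> n a * Defs.monom (\<phi> a) x)"
  shows "stable_or_zero (\<lambda>x. \<Sum>a\<in>A. \<kappa>' a * Defs.monom (\<phi> a) x)"
proof (rule stable_or_zero_limit[OF _ _ sz])
  fix S :: "(complex ^ 'v) set" assume S: "compact S"
  show "uniform_limit S (\<lambda>n x. \<Sum>a\<in>A. \<kappa> n a * Defs.monom (\<phi> a) x)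
      (\<lambda>x. \<Sum>a\<in>A. \<kappa>' a * Defs.monom (\<phi> a) x) sequentially"
    using A lim
  proof (induction A)
    case empty
    then show ?case by (simp add: uniform_limit_const)
  next
    case (insert a A)
    have "bounded (Defs.monom (\<phi> a) ` S)"
      using S by (intro compact_imp_bounded compact_continuous_image continuous_on_monom)
    then have "uniform_limit S (\<lambda>n x. \<kappa> n a * Defs.monom (\<phi> a) x)
        (\<lambda>x. \<kappa>' a * Defs.monom (\<phi> a) x) sequentially"
      using insert.prems[of a]
      by (intro uniform_lim_mult) (auto simp: uniform_limit_iff tendsto_iff bounded_iff)
    with insert show ?case by (simp add: uniform_limit_add)
  qed
qed (intro holomorphic_intros holomorphic_monom_line)

text \<open>The complex line through (i, ..., i) and any \<open>x\<close> meets the half-space in an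
  open set, so the identity theorem gives the value 0 at \<open>x\<close>. The Cauchy estimate with
  bound 0 then kills every coefficient.\<close>

lemma power_series_zero_imp_coeffs_zero:
  fixes c :: "('v::finite \<Rightarrow> nat) \<Rightarrow> complex"
  assumes fin: "finite {\<alpha>. c \<alpha> \<noteq> 0}" and z: "\<And>x. x \<in> upper_halfspace \<Longrightarrow> power_series c x = 0"
  shows "c \<alpha> = 0"
proof -
  let ?A = "{\<alpha>. c \<alpha> \<noteq> 0}"
  have ps: "power_series c x = (\<Sum>\<alpha>\<in>?A. c \<alpha> * Defs.monom \<alpha> x)" for x
    by (rule power_series_finite[OF fin]) auto
  have zero: "power_series c x = 0" for x
  proof -
    define p :: "complex ^ 'v" where "p = (\<chi> i. \<i>)"
    define U where "U = {t. p + t *s (x - p) \<in> upper_halfspace}"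
    have "power_series c (p + 1 *s (x - p)) = 0"
    proof (rule analytic_continuation_open[of U UNIV "\<lambda>t. power_series c (p + t *s (x - p))" "\<lambda>_. 0"])
      show "open U" unfolding U_def by (rule open_convex_line_upper_halfspace)
      have "0 \<in> U" by (simp add: U_def p_def upper_halfspace_def)
      then show "U \<noteq> {}" by auto
      show "(\<lambda>t. power_series c (p + t *s (x - p))) holomorphic_on UNIV"
        unfolding ps by (intro holomorphic_intros holomorphic_monom_line)
    qed (auto simp: U_def z)
    then show ?thesis by (simp add: vec_eq_iff)
  qed
  have "cmod (c \<alpha>) * 1 ^ tdeg \<alpha> \<le> 0"
    by (rule Cauchy_bound) (auto simp: zero entire_coeffs_finite fin)
  then show ?thesis by simp
qed

text \<open>Dominated convergence: the majorant makes the tails small uniformly in \<open>n\<close>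
  and on \<open>S\<close>, and for the remaining finitely many indices coefficientwise convergence
  is enough.\<close>

lemma power_series_uniform_limit:
  fixes c :: "nat \<Rightarrow> ('v::finite \<Rightarrow> nat) \<Rightarrow> complex"
  assumes lim: "\<And>\<alpha>. (\<lambda>n. c n \<alpha>) \<longlonglongrightarrow> c' \<alpha>"
    and bd: "\<And>n \<alpha>. cmod (c n \<alpha>) \<le> g \<alpha>"
    and g: "\<And>\<rho>. \<rho> \<ge> 0 \<Longrightarrow> (\<lambda>\<alpha>. g \<alpha> * \<rho> ^ tdeg \<alpha>) summable_on UNIV"
    and S: "compact S"
  shows "uniform_limit S (\<lambda>n. power_series (c n)) (power_series c') sequentially"
proof -
  have bd': "cmod (c' \<alpha>) \<le> g \<alpha>" for \<alpha>
    using lim[of \<alpha>] bd by (intro LIMSEQ_le_const2[OF tendsto_norm]) auto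
  have ent: "entire_coeffs b" if "\<And>\<alpha>. cmod (b \<alpha>) \<le> g \<alpha>" for b
    unfolding entire_coeffs_def
    using that g by (auto intro!: summable_on_comparison_test[OF g] mult_right_mono)
  obtain \<rho> where \<rho>: "\<rho> > 0" "\<And>x. x \<in> S \<Longrightarrow> norm x \<le> \<rho>"
    using compact_imp_bounded[OF S] bounded_pos by blast
  let ?g = "\<lambda>\<alpha>. g \<alpha> * \<rho> ^ tdeg \<alpha>"
  have g0: "g \<alpha> \<ge> 0" for \<alpha> using bd'[of \<alpha>] norm_ge_zero order_trans by blast
  have sg: "?g summable_on UNIV" using g \<rho> by simp
  show ?thesis
  proof (rule uniform_limitI)
    fix e :: real assume e: "e > 0"
    \<comment> \<open>The terms of the difference are bounded by twice the majorant, so the tail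
      costs e/2; the finite part will cost less than e/4.\<close>
    obtain A where A: "finite A" "dist (sum ?g A) (infsum ?g UNIV) \<le> e / 4"
      using infsum_finite_approximation[OF sg, of "e / 4"] e by auto
    have sgc: "?g summable_on (- A)" using sg by (rule summable_on_subset_banach) auto
    have "infsum ?g (- A) = infsum ?g UNIV - sum ?g A"
      using infsum_Diff[of ?g UNIV A] sg A by (simp add: Compl_eq_Diff_UNIV)
    then have tail: "infsum ?g (- A) \<le> e / 4" using A(2) unfolding dist_real_def by linarith
    have "(\<lambda>n. \<Sum>\<alpha>\<in>A. cmod (c n \<alpha> - c' \<alpha>) * \<rho> ^ tdeg \<alpha>) \<longlonglongrightarrow> (\<Sum>\<alpha>\<in>A. cmod (c' \<alpha> - c' \<alpha>) * \<rho> ^ tdeg \<alpha>)"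
      by (intro tendsto_intros lim)
    then have "\<forall>\<^sub>F n in sequentially. (\<Sum>\<alpha>\<in>A. cmod (c n \<alpha> - c' \<alpha>) * \<rho> ^ tdeg \<alpha>) < e / 4"
      using e by (intro order_tendstoD(2)) auto
    then show "\<forall>\<^sub>F n in sequentially. \<forall>x\<in>S. dist (power_series (c n) x) (power_series c' x) < e"
    proof eventually_elim
      case (elim n)
      show ?case
      proof
        fix x assume x: "x \<in> S"
        define d where "d = (\<lambda>\<alpha>. c n \<alpha> * Defs.monom \<alpha> x - c' \<alpha> * Defs.monom \<alpha> x)"
        have sm: "(\<lambda>\<alpha>. c n \<alpha> * Defs.monom \<alpha> x) summable_on UNIV" "(\<lambda>\<alpha>. c' \<alpha> * Defs.monom \<alpha> x) summable_on UNIV"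
          using ent bd bd' by (auto intro: summable_on_power_series)
        have hd: "(d has_sum (power_series (c n) x - power_series c' x)) UNIV"
          unfolding d_def power_series_def
          using has_sum_add[OF has_sum_infsum[OF sm(1)] has_sum_uminusI[OF has_sum_infsum[OF sm(2)]]]
          by simp
        then have sd: "d summable_on UNIV" by (rule has_sum_imp_summable)
        have mon: "cmod (Defs.monom \<alpha> x) \<le> \<rho> ^ tdeg \<alpha>" for \<alpha>
          using \<rho>(2)[OF x] by (intro norm_monom_le order_trans[OF Finite_Cartesian_Product.norm_nth_le])
        have d: "cmod (d \<alpha>) \<le> cmod (c n \<alpha> - c' \<alpha>) * \<rho> ^ tdeg \<alpha>" for \<alpha>
          using mon[of \<alpha>] by (simp add: d_def norm_mult mult_left_mono flip: left_diff_distrib)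
        have d2: "cmod (d \<alpha>) \<le> 2 * ?g \<alpha>" for \<alpha>
        proof -
          have "cmod (c n \<alpha> - c' \<alpha>) \<le> 2 * g \<alpha>"
            using norm_triangle_ineq4[of "c n \<alpha>" "c' \<alpha>"] bd[of n \<alpha>] bd'[of \<alpha>] by linarith
          then have "cmod (c n \<alpha> - c' \<alpha>) * \<rho> ^ tdeg \<alpha> \<le> 2 * g \<alpha> * \<rho> ^ tdeg \<alpha>"
            using \<rho>(1) by (intro mult_right_mono) auto
          then show ?thesis using d[of \<alpha>] by simp
        qed
        have "power_series (c n) x - power_series c' x = infsum d UNIV"
          using hd by (simp add: infsumI)
        also have "\<dots> = sum d A + infsum d (- A)"
          using infsum_Diff[of d UNIV A] sd A by (simp add: Compl_eq_Diff_UNIV)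
        also have "cmod \<dots> \<le> cmod (sum d A) + cmod (infsum d (- A))" by (rule norm_triangle_ineq)
        also have "cmod (sum d A) \<le> (\<Sum>\<alpha>\<in>A. cmod (c n \<alpha> - c' \<alpha>) * \<rho> ^ tdeg \<alpha>)"
          by (intro order_trans[OF norm_sum] sum_mono d)
        also have "cmod (infsum d (- A)) \<le> infsum (\<lambda>\<alpha>. 2 * ?g \<alpha>) (- A)"
          by (intro norm_infsum_le[OF has_sum_infsum has_sum_infsum] d2
              summable_on_cmult_right sgc summable_on_subset_banach[OF sd]) auto
        also have "infsum (\<lambda>\<alpha>. 2 * ?g \<alpha>) (- A) = 2 * infsum ?g (- A)" by (rule infsum_cmult_right')
        finally show "dist (power_series (c n) x) (power_series c' x) < e"
          using elim tail e unfolding dist_norm by linarith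
      qed
    qed
  qed
qed

section \<open>Falling factorial multipliers\<close>

text \<open>This undoes the shift by \<open>z n\<close>: the coefficients of (z + t)^a tend to those
  of t^a as z tends to 0.\<close>

lemma tendsto_coeff_linear_power:
  fixes z :: "nat \<Rightarrow> complex"
  assumes "z \<longlonglongrightarrow> 0"
  shows "(\<lambda>n. coeff ([:z n, 1:] ^ a) l) \<longlonglongrightarrow> (if l = a then 1 else 0)"
proof (induction a arbitrary: l)
  case 0
  then show ?case by (simp add: coeff_1)
next
  case (Suc a)
  have eq: "coeff ([:z n, 1:] ^ Suc a) l
      = z n * coeff ([:z n, 1:] ^ a) l + (case l of 0 \<Rightarrow> 0 | Suc k \<Rightarrow> coeff ([:z n, 1:] ^ a) k)" for n
    by (simp add: coeff_pCons)
  have "(\<lambda>n. z n * coeff ([:z n, 1:] ^ a) l + (case l of 0 \<Rightarrow> 0 | Suc k \<Rightarrow> coeff ([:z n, 1:] ^ a) k))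
      \<longlonglongrightarrow> 0 * (if l = a then 1 else 0) + (case l of 0 \<Rightarrow> 0 | Suc k \<Rightarrow> if k = a then 1 else 0)"
    using Suc.IH by (intro tendsto_add tendsto_mult assms) (auto split: nat.split)
  also have "0 * (if l = a then 1 else 0) + (case l of 0 \<Rightarrow> 0 | Suc k \<Rightarrow> if k = a then 1 else 0)
      = (if l = Suc a then 1 else (0::complex))"
    by (auto split: nat.split)
  finally show ?case unfolding eq .
qed

lemma monom_remove:
  fixes x :: "complex ^ 'v::finite"
  shows "Defs.monom \<alpha> x = (\<Prod>i\<in>UNIV - {j}. x $ i ^ \<alpha> i) * (x $ j) ^ \<alpha> j"
  unfolding Defs.monom_def by (subst prod.remove[of UNIV j]) (auto simp: mult.commute)

text \<open>The univariate multiplier needs a nonzero constant coefficient, which the shift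
  \<open>x\<^sub>j \<mapsto> x\<^sub>j + \<i>\<epsilon>\<close> provides.\<close>
lemma stable_or_zero_falling_multiplier:
  fixes c :: "('v::finite \<Rightarrow> nat) \<Rightarrow> complex"
  assumes fin: "finite {\<alpha>. c \<alpha> \<noteq> 0}" and sz: "stable_or_zero (power_series c)"
  shows "stable_or_zero (power_series (\<lambda>\<alpha>. of_nat (falling b (\<alpha> j)) * c \<alpha>))"
proof (cases "\<forall>x\<in>upper_halfspace. power_series c x = 0")
  case True
  then have "c \<alpha> = 0" for \<alpha>
    using power_series_zero_imp_coeffs_zero[OF fin] by blast
  then show ?thesis by (simp add: stable_or_zero_def power_series_def)
next
  case False
  then have nz: "power_series c x \<noteq> 0" if "x \<in> upper_halfspace" for x
    using sz that by (auto simp: stable_or_zero_def)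
  define A where "A = {\<alpha>. c \<alpha> \<noteq> 0}"
  have A: "finite A" using fin by (simp add: A_def)
  define \<epsilon> where "\<epsilon> = (\<lambda>n. inverse (real (Suc n)))"
  define z where "z = (\<lambda>n. \<i> * of_real (\<epsilon> n))"
  have \<epsilon>: "\<epsilon> n > 0" for n by (simp add: \<epsilon>_def)
  have "\<epsilon> \<longlonglongrightarrow> 0" unfolding \<epsilon>_def by (rule LIMSEQ_inverse_real_of_nat)
  then have "z \<longlonglongrightarrow> \<i> * of_real 0" unfolding z_def by (intro tendsto_intros)
  then have z: "z \<longlonglongrightarrow> 0" by simp
  \<comment> \<open>The power of the shifted variable is expanded and the multiplier is applied to
    each resulting power \<open>l\<close> of the j-th variable. In the limit only
    \<open>l = \<alpha> j\<close> remains.\<close>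
  let ?\<kappa> = "\<lambda>n (\<alpha>, l). of_nat (falling b l) * c \<alpha> * coeff ([:z n, 1:] ^ \<alpha> j) l"
  let ?\<kappa>' = "\<lambda>(\<alpha>, l). of_nat (falling b l) * c \<alpha> * (if l = \<alpha> j then 1 else 0)"
  let ?\<phi> = "\<lambda>(\<alpha>, l). \<alpha>(j := l)"
  have "stable_or_zero (\<lambda>x. \<Sum>a\<in>A \<times> {..b}. ?\<kappa>' a * Defs.monom (?\<phi> a) x)"
  proof (rule stable_or_zero_limit_sum)
    show "finite (A \<times> {..b})" using A by simp
    show "(\<lambda>n. ?\<kappa> n a) \<longlonglongrightarrow> ?\<kappa>' a" for a
      using tendsto_coeff_linear_power[OF z]
      by (cases a) (auto simp only: prod.case intro!: tendsto_mult tendsto_const)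
    show "stable_or_zero (\<lambda>x. \<Sum>a\<in>A \<times> {..b}. ?\<kappa> n a * Defs.monom (?\<phi> a) x)" for n
      unfolding stable_or_zero_def
    proof (intro disjI1 ballI)
      fix x :: "complex ^ 'v" assume x: "x \<in> upper_halfspace"
      define r where "r = (\<lambda>\<alpha>. \<Prod>i\<in>UNIV - {j}. x $ i ^ \<alpha> i)"
      define Q where "Q = (\<Sum>\<alpha>\<in>A. smult (c \<alpha> * r \<alpha>) ([:z n, 1:] ^ \<alpha> j))"
      have Q: "poly Q t = power_series c (\<chi> i. if i = j then z n + t else x $ i)" for t
      proof -
        have "power_series c (\<chi> i. if i = j then z n + t else x $ i)
            = (\<Sum>\<alpha>\<in>A. c \<alpha> * Defs.monom \<alpha> (\<chi> i. if i = j then z n + t else x $ i))"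
          using A by (intro power_series_finite) (auto simp: A_def)
        also have "\<dots> = poly Q t"
          unfolding Q_def poly_sum monom_remove[of _ _ j]
          by (intro sum.cong refl) (simp add: r_def mult.assoc)
        finally show ?thesis ..
      qed
      \<comment> \<open>Because of the shift the real axis is included; t = 0 shows that the
        constant coefficient of \<open>Q\<close> is nonzero.\<close>
      have "poly Q t \<noteq> 0" if "Im t \<ge> 0" for t
        unfolding Q using that x \<epsilon>[of n]
        by (intro nz) (auto simp: upper_halfspace_def z_def)
      then have "(\<Sum>l\<le>b. of_nat (falling b l) * coeff Q l * (x $ j) ^ l) \<noteq> 0"
        using x by (intro falling_multiplier_univariate)
          (auto simp: upper_halfspace_def simp flip: poly_0_coeff_0)
      also have "(\<Sum>l\<le>b. of_nat (falling b l) * coeff Q l * (x $ j) ^ l)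
          = (\<Sum>a\<in>A \<times> {..b}. ?\<kappa> n a * Defs.monom (?\<phi> a) x)"
      proof -
        have "Defs.monom (\<alpha>(j := l)) x = r \<alpha> * (x $ j) ^ l" for \<alpha> l
          unfolding monom_remove[of _ _ j] r_def by (auto intro!: prod.cong)
        then have "(\<Sum>a\<in>A \<times> {..b}. ?\<kappa> n a * Defs.monom (?\<phi> a) x)
          = (\<Sum>\<alpha>\<in>A. \<Sum>l\<le>b. of_nat (falling b l) * c \<alpha> * coeff ([:z n, 1:] ^ \<alpha> j) l * (r \<alpha> * (x $ j) ^ l))"
          by (simp add: sum.cartesian_product split_def)
        also have "\<dots> = (\<Sum>l\<le>b. of_nat (falling b l) * coeff Q l * (x $ j) ^ l)"
          by (subst sum.swap) (simp add: Q_def coeff_sum sum_distrib_left sum_distrib_right mult_ac)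
        finally show ?thesis ..
      qed
      finally show "(\<Sum>a\<in>A \<times> {..b}. ?\<kappa> n a * Defs.monom (?\<phi> a) x) \<noteq> 0" .
    qed
  qed
  also have "(\<lambda>x. \<Sum>a\<in>A \<times> {..b}. ?\<kappa>' a * Defs.monom (?\<phi> a) x)
      = power_series (\<lambda>\<alpha>. of_nat (falling b (\<alpha> j)) * c \<alpha>)"
  proof
    fix x
    have "(\<Sum>a\<in>A \<times> {..b}. ?\<kappa>' a * Defs.monom (?\<phi> a) x)
        = (\<Sum>\<alpha>\<in>A. \<Sum>l\<le>b. if l = \<alpha> j then of_nat (falling b (\<alpha> j)) * c \<alpha> * Defs.monom \<alpha> x else 0)"
      unfolding sum.cartesian_product by (intro sum.cong) auto
    \<comment> \<open>If \<open>\<alpha> j > b\<close>, no \<open>l\<close> matches, and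
      \<open>falling b (\<alpha> j)\<close> is 0 as well.\<close>
    also have "\<dots> = (\<Sum>\<alpha>\<in>A. of_nat (falling b (\<alpha> j)) * c \<alpha> * Defs.monom \<alpha> x)"
      by (intro sum.cong refl) (auto simp: falling_def)
    also have "\<dots> = power_series (\<lambda>\<alpha>. of_nat (falling b (\<alpha> j)) * c \<alpha>) x"
      using A by (intro power_series_finite[symmetric]) (auto simp: A_def)
    finally show "(\<Sum>a\<in>A \<times> {..b}. ?\<kappa>' a * Defs.monom (?\<phi> a) x)
      = power_series (\<lambda>\<alpha>. of_nat (falling b (\<alpha> j)) * c \<alpha>) x" .
  qed
  finally show ?thesis .
qed

text \<open>One variable is treated at a time. The set \<open>J\<close> will be the set of
  w-coordinates, so that the z-variables stay unchanged.\<close>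

lemma stable_or_zero_falling_multipliers:
  fixes c :: "('v::finite \<Rightarrow> nat) \<Rightarrow> complex"
  assumes fin: "finite {\<alpha>. c \<alpha> \<noteq> 0}" and sz: "stable_or_zero (power_series c)"
  shows "stable_or_zero (power_series (\<lambda>\<alpha>. of_nat (\<Prod>j\<in>J. falling (\<beta> j) (\<alpha> j)) * c \<alpha>))"
proof (induction J rule: finite_induct[OF finite])
  case 1
  then show ?case using sz by simp
next
  case (2 j J)
  have "stable_or_zero (power_series
      (\<lambda>\<alpha>. of_nat (falling (\<beta> j) (\<alpha> j)) * (of_nat (\<Prod>j\<in>J. falling (\<beta> j) (\<alpha> j)) * c \<alpha>)))"
    using 2 by (intro stable_or_zero_falling_multiplier finite_subset[OF _ fin]) auto
  then show ?case using 2 by (simp add: mult.assoc)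
qed

section \<open>Coefficient bounds for stable polynomials\<close>

text \<open>The weights of the \<open>a\<close>-th finite difference with step \<open>h\<close>.\<close>
lemma finite_difference_weights:
  fixes h :: complex
  shows "\<exists>u. (\<Sum>j\<le>a. cmod (u j)) \<le> 2 ^ a \<and>
    (\<forall>g\<le>a. \<forall>x. (\<Sum>j\<le>a. u j * (x + of_nat j * h) ^ g) = (if g = a then fact a * h ^ a else 0))"
proof (induction a)
  case 0
  then show ?case by (intro exI[of _ "\<lambda>_. 1"]) simp
next
  case (Suc a)
  then obtain u where u1: "(\<Sum>j\<le>a. cmod (u j)) \<le> 2 ^ a" and
    u2: "\<And>g x. g \<le> a \<Longrightarrow> (\<Sum>j\<le>a. u j * (x + of_nat j * h) ^ g) = (if g = a then fact a * h ^ a else 0)"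
    by blast
  \<comment> \<open>The next difference is the difference shifted by one step minus the unshifted
    one; \<open>v1\<close> and \<open>v2\<close> place both on the nodes up to
    \<open>Suc a\<close>.\<close>
  define v1 where "v1 = (\<lambda>j. case j of 0 \<Rightarrow> 0 | Suc k \<Rightarrow> u k)"
  define v2 where "v2 = (\<lambda>j. if j \<le> a then u j else 0)"
  have v1: "(\<Sum>j\<le>Suc a. f j (v1 j)) = f 0 0 + (\<Sum>j\<le>a. f (Suc j) (u j))"
    for f :: "nat \<Rightarrow> complex \<Rightarrow> 'z :: comm_monoid_add"
    unfolding v1_def by (subst sum.atMost_Suc_shift) simp
  have v2: "(\<Sum>j\<le>Suc a. f j (v2 j)) = (\<Sum>j\<le>a. f j (u j)) + f (Suc a) 0"
    for f :: "nat \<Rightarrow> complex \<Rightarrow> 'z :: comm_monoid_add"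
    unfolding v2_def by simp
  have "(\<Sum>j\<le>Suc a. cmod (v1 j - v2 j)) \<le> (\<Sum>j\<le>Suc a. cmod (v1 j) + cmod (v2 j))"
    by (intro sum_mono norm_triangle_ineq4)
  also have "\<dots> \<le> 2 ^ Suc a"
    using u1 unfolding sum.distrib v1[of "\<lambda>_. cmod"] v2[of "\<lambda>_. cmod"] by simp
  finally have b: "(\<Sum>j\<le>Suc a. cmod (v1 j - v2 j)) \<le> 2 ^ Suc a" .
  have "(\<Sum>j\<le>Suc a. (v1 j - v2 j) * (x + of_nat j * h) ^ g)
      = (if g = Suc a then fact (Suc a) * h ^ Suc a else 0)" if g: "g \<le> Suc a" for g x
  proof -
    have "(\<Sum>j\<le>Suc a. (v1 j - v2 j) * (x + of_nat j * h) ^ g)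
        = (\<Sum>j\<le>Suc a. v1 j * (x + of_nat j * h) ^ g) - (\<Sum>j\<le>Suc a. v2 j * (x + of_nat j * h) ^ g)"
      by (simp only: left_diff_distrib sum_subtractf)
    also have "\<dots> = (\<Sum>j\<le>a. u j * (((x + of_nat j * h) + h) ^ g - (x + of_nat j * h) ^ g))"
      using v1[of "\<lambda>j v. v * (x + of_nat j * h) ^ g"] v2[of "\<lambda>j v. v * (x + of_nat j * h) ^ g"]
      by (simp add: right_diff_distrib sum_subtractf algebra_simps)
    \<comment> \<open>Taking one difference lowers the degree: only powers
      \<open>i < g \<le> Suc a\<close> remain, to which the induction hypothesis applies. Only
      \<open>i = a\<close> survives, and the binomial coefficient a + 1 turns \<open>fact a\<close>
      into \<open>fact (Suc a)\<close>.\<close>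
    also have "\<dots> = (\<Sum>j\<le>a. u j * (\<Sum>i<g. of_nat (g choose i) * (x + of_nat j * h) ^ i * h ^ (g - i)))"
      by (simp add: binomial_ring lessThan_Suc_atMost[symmetric])
    also have "\<dots> = (\<Sum>i<g. of_nat (g choose i) * h ^ (g - i) * (\<Sum>j\<le>a. u j * (x + of_nat j * h) ^ i))"
      unfolding sum_distrib_left by (subst sum.swap) (simp add: mult_ac)
    also have "\<dots> = (\<Sum>i<g. of_nat (g choose i) * h ^ (g - i) * (if i = a then fact a * h ^ a else 0))"
      using g by (intro sum.cong refl, subst u2) auto
    also have "\<dots> = (\<Sum>i<g. if i = a then of_nat (g choose a) * h ^ (g - a) * (fact a * h ^ a) else 0)"
      by (intro sum.cong) auto
    also have "\<dots> = (if a < g then of_nat (g choose a) * h ^ (g - a) * (fact a * h ^ a) else 0)"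
      by simp
    also have "\<dots> = (if g = Suc a then fact (Suc a) * h ^ Suc a else 0)"
      using g by (cases "g = Suc a") (auto simp: algebra_simps)
    finally show ?thesis .
  qed
  with b show ?case by (intro exI[of _ "\<lambda>j. v1 j - v2 j"]) blast
qed

section \<open>Homogeneous parts and their values at positive real points\<close>

definition homogeneous_part :: "(('v::finite \<Rightarrow> nat) \<Rightarrow> complex) \<Rightarrow> nat \<Rightarrow> complex ^ 'v \<Rightarrow> complex" where
  "homogeneous_part c d x = (\<Sum>\<alpha> | tdeg \<alpha> = d. c \<alpha> * Defs.monom \<alpha> x)"

text \<open>The reciprocal d^a / a! is a single term of the series for exp d. The left side is the
  value of the a-th difference with step 1/d on the a-th power.\<close>

lemma fact_mult_inverse_power_ge:
  assumes "a \<le> d"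
  shows "fact a * (1 / real d) ^ a \<ge> exp (- real d)"
proof (cases "d = 0")
  case False
  have "real d ^ a / fact a \<le> exp (real d)"
  proof -
    have "(\<Sum>n\<in>{a}. real d ^ n /\<^sub>R fact n) \<le> (\<Sum>n. real d ^ n /\<^sub>R fact n)"
      by (intro sum_le_suminf summable_exp_generic) auto
    then show ?thesis by (simp add: exp_def divide_inverse mult.commute)
  qed
  then have "inverse (exp (real d)) \<le> inverse (real d ^ a / fact a)"
    using False by (intro le_imp_inverse_le) auto
  then show ?thesis by (simp add: exp_minus power_inverse divide_inverse mult.commute)
qed (use assms in auto)

text \<open>Taking a difference of order \<alpha> i in each coordinate i isolates the coefficient of
  \<alpha> among all terms of the same degree d. The weights contribute 2^d in total, and dividing
  by the value on the monomial costs at most exp d per coordinate.\<close>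

lemma homogeneous_coeff_bound:
  fixes c :: "('v::finite \<Rightarrow> nat) \<Rightarrow> complex"
  assumes M: "\<And>s :: 'v \<Rightarrow> real. (\<And>i. 1 \<le> s i \<and> s i \<le> 2) \<Longrightarrow>
      cmod (homogeneous_part c (tdeg \<alpha>) (\<chi> i. of_real (s i))) \<le> M"
  shows "cmod (c \<alpha>) \<le> M * (2 * exp (real CARD('v))) ^ tdeg \<alpha>"
proof -
  define d where "d = tdeg \<alpha>"
  define h :: real where "h = 1 / real d"
  have "\<forall>a. \<exists>u. (\<Sum>j\<le>a. cmod (u j)) \<le> 2 ^ a \<and> (\<forall>g\<le>a. \<forall>x.
      (\<Sum>j\<le>a. u j * (x + of_nat j * complex_of_real h) ^ g) = (if g = a then fact a * of_real h ^ a else 0))"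
    by (intro allI finite_difference_weights)
  from choice[OF this] obtain u where u: "\<forall>a. (\<Sum>j\<le>a. cmod (u a j)) \<le> 2 ^ a \<and> (\<forall>g\<le>a. \<forall>x.
      (\<Sum>j\<le>a. u a j * (x + of_nat j * complex_of_real h) ^ g) = (if g = a then fact a * of_real h ^ a else 0))"
    by (rule exE)
  have u1: "(\<Sum>j\<le>a. cmod (u a j)) \<le> 2 ^ a" for a using u by simp
  have u2: "(\<Sum>j\<le>a. u a j * (x + of_nat j * of_real h) ^ g) = (if g = a then fact a * of_real h ^ a else 0)"
    if "g \<le> a" for a g x using u that by simp
  define P where "P = PiE (UNIV :: 'v set) (\<lambda>i. {..\<alpha> i})"
  define pt :: "('v \<Rightarrow> nat) \<Rightarrow> complex ^ 'v" where "pt = (\<lambda>J. \<chi> i. of_real (1 + real (J i) * h))"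
  have P: "finite P" unfolding P_def by (intro finite_PiE) auto
  have M0: "M \<ge> 0" by (rule order_trans[OF norm_ge_zero M[of "\<lambda>_. 1"]]) simp
  have "(\<Sum>J\<in>P. (\<Prod>i\<in>UNIV. u (\<alpha> i) (J i)) * homogeneous_part c d (pt J))
      = (\<Sum>\<gamma> | tdeg \<gamma> = d. c \<gamma> * (\<Sum>J\<in>P. \<Prod>i\<in>UNIV. u (\<alpha> i) (J i) * (1 + of_nat (J i) * of_real h) ^ \<gamma> i))"
    unfolding homogeneous_part_def sum_distrib_left
    by (subst sum.swap) (simp add: Defs.monom_def pt_def prod.distrib mult_ac)
  also have "\<dots> = (\<Sum>\<gamma> | tdeg \<gamma> = d. c \<gamma> * (\<Prod>i\<in>UNIV. \<Sum>j\<le>\<alpha> i. u (\<alpha> i) j * (1 + of_nat j * of_real h) ^ \<gamma> i))"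
    unfolding P_def by (subst prod_sum_PiE) auto
  also have "\<dots> = (\<Sum>\<gamma> | tdeg \<gamma> = d. if \<gamma> = \<alpha> then c \<alpha> * (\<Prod>i\<in>UNIV. fact (\<alpha> i) * of_real h ^ \<alpha> i) else 0)"
  proof (intro sum.cong refl)
    fix \<gamma> :: "'v \<Rightarrow> nat" assume "\<gamma> \<in> {\<gamma>. tdeg \<gamma> = d}"
    then have eq: "tdeg \<gamma> = tdeg \<alpha>" by (simp add: d_def)
    show "c \<gamma> * (\<Prod>i\<in>UNIV. \<Sum>j\<le>\<alpha> i. u (\<alpha> i) j * (1 + of_nat j * of_real h) ^ \<gamma> i)
        = (if \<gamma> = \<alpha> then c \<alpha> * (\<Prod>i\<in>UNIV. fact (\<alpha> i) * of_real h ^ \<alpha> i) else 0)"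
    proof (cases "\<gamma> = \<alpha>")
      case True
      then show ?thesis by (simp add: u2)
    next
      case False
      \<comment> \<open>Distinct multi-indices of equal total degree are incomparable, and a
        difference of order \<alpha> i annihilates the lower power \<gamma> i.\<close>
      have "\<exists>i. \<gamma> i < \<alpha> i"
      proof (rule ccontr)
        assume "\<not> ?thesis"
        then have le: "\<alpha> i \<le> \<gamma> i" for i by (simp add: not_less)
        have "\<gamma> i \<le> \<alpha> i" for i
        proof (rule ccontr)
          assume "\<not> ?thesis"
          then have "tdeg \<alpha> < tdeg \<gamma>"
            unfolding tdeg_def using le by (intro sum_strict_mono_ex1) (auto simp: not_le)
          then show False using eq by simp
        qed
        then show False using le False by (auto simp: fun_eq_iff intro: antisym)
      qed
      then obtain i where "\<gamma> i < \<alpha> i" by blast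
      then have "(\<Sum>j\<le>\<alpha> i. u (\<alpha> i) j * (1 + of_nat j * of_real h) ^ \<gamma> i) = 0"
        by (subst u2) auto
      then have "(\<Prod>i\<in>UNIV. \<Sum>j\<le>\<alpha> i. u (\<alpha> i) j * (1 + of_nat j * of_real h) ^ \<gamma> i) = 0"
        by (intro prod_zero) auto
      then show ?thesis using False by simp
    qed
  qed
  also have "\<dots> = c \<alpha> * (\<Prod>i\<in>UNIV. fact (\<alpha> i) * of_real h ^ \<alpha> i)"
    by (simp add: d_def finite_tdeg_eq)
  finally have eq: "c \<alpha> * (\<Prod>i\<in>UNIV. fact (\<alpha> i) * of_real h ^ \<alpha> i)
      = (\<Sum>J\<in>P. (\<Prod>i\<in>UNIV. u (\<alpha> i) (J i)) * homogeneous_part c d (pt J))" ..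
  have "cmod (\<Sum>J\<in>P. (\<Prod>i\<in>UNIV. u (\<alpha> i) (J i)) * homogeneous_part c d (pt J))
      \<le> (\<Sum>J\<in>P. (\<Prod>i\<in>UNIV. cmod (u (\<alpha> i) (J i))) * M)"
  proof (intro order_trans[OF norm_sum] sum_mono)
    fix J assume "J \<in> P"
    then have J: "J i \<le> \<alpha> i" for i by (auto simp: P_def)
    \<comment> \<open>The step 1/d is chosen for this: at most d steps from 1 do not lead beyond
      2.\<close>
    have "1 \<le> 1 + real (J i) * h \<and> 1 + real (J i) * h \<le> 2" for i
    proof -
      have "J i \<le> d" using J[of i] le_tdeg[of \<alpha> i] by (simp add: d_def)
      then show ?thesis by (auto simp: h_def divide_le_eq)
    qed
    then have "cmod (homogeneous_part c d (pt J)) \<le> M"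
      unfolding pt_def d_def by (rule M)
    then show "cmod ((\<Prod>i\<in>UNIV. u (\<alpha> i) (J i)) * homogeneous_part c d (pt J))
        \<le> (\<Prod>i\<in>UNIV. cmod (u (\<alpha> i) (J i))) * M"
      by (simp add: norm_mult prod_norm mult_left_mono prod_nonneg)
  qed
  also have "\<dots> = (\<Prod>i\<in>UNIV. \<Sum>j\<le>\<alpha> i. cmod (u (\<alpha> i) j)) * M"
    unfolding P_def by (subst prod_sum_PiE) (auto simp: sum_distrib_right)
  also have "\<dots> \<le> (\<Prod>i\<in>UNIV. 2 ^ \<alpha> i) * M"
    using M0 by (intro mult_right_mono prod_mono) (auto intro: u1 sum_nonneg)
  also have "\<dots> = 2 ^ d * M" by (simp add: d_def tdeg_def power_sum)
  finally have 1: "cmod (c \<alpha>) * (\<Prod>i\<in>UNIV. fact (\<alpha> i) * h ^ \<alpha> i) \<le> 2 ^ d * M"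
    unfolding eq[symmetric] by (simp add: norm_mult h_def norm_power norm_divide flip: prod_norm)
  have "(\<Prod>i\<in>(UNIV::'v set). exp (- real d)) \<le> (\<Prod>i\<in>UNIV. fact (\<alpha> i) * h ^ \<alpha> i)"
    unfolding h_def d_def by (intro prod_mono conjI fact_mult_inverse_power_ge le_tdeg) auto
  then have "cmod (c \<alpha>) * exp (- real d) ^ CARD('v) \<le> 2 ^ d * M"
    using order_trans[OF mult_left_mono[of _ _ "cmod (c \<alpha>)"] 1] by simp
  moreover have "exp (- real d) ^ CARD('v) * exp (real CARD('v)) ^ d = 1"
    by (simp add: mult.commute flip: exp_of_nat_mult exp_add)
  ultimately have "cmod (c \<alpha>) * (exp (- real d) ^ CARD('v) * exp (real CARD('v)) ^ d)
      \<le> 2 ^ d * M * exp (real CARD('v)) ^ d"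
    unfolding mult.assoc[symmetric] by (intro mult_right_mono) auto
  with \<open>exp (- real d) ^ CARD('v) * exp (real CARD('v)) ^ d = 1\<close> show ?thesis
    by (simp add: d_def power_mult_distrib mult_ac)
qed

lemma homogeneous_part_vector_scale:
  "homogeneous_part c d (t *s x) = t ^ d * homogeneous_part c d x"
  unfolding homogeneous_part_def sum_distrib_left
  by (intro sum.cong refl) (simp add: monom_vector_scale)

lemma homogeneous_part_power_series:
  "homogeneous_part c d = power_series (\<lambda>\<alpha>. if tdeg \<alpha> = d then c \<alpha> else 0)"
proof
  fix x
  have "power_series (\<lambda>\<alpha>. if tdeg \<alpha> = d then c \<alpha> else 0) x
      = (\<Sum>\<alpha> | tdeg \<alpha> = d. (if tdeg \<alpha> = d then c \<alpha> else 0) * Defs.monom \<alpha> x)"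
    by (rule power_series_finite[OF finite_tdeg_eq]) (auto split: if_splits)
  then show "homogeneous_part c d x = power_series (\<lambda>\<alpha>. if tdeg \<alpha> = d then c \<alpha> else 0) x"
    by (simp add: homogeneous_part_def)
qed

lemma scaled_mem_upper_halfspace:
  "x \<in> upper_halfspace \<Longrightarrow> s > 0 \<Longrightarrow> complex_of_real s *s x \<in> upper_halfspace"
  by (simp add: upper_halfspace_def)

text \<open>Positive scaling preserves the half-space, and \<epsilon>^(-r) times the polynomial at
  \<epsilon> x tends to its part of degree r as \<epsilon> tends to 0.\<close>

lemma stable_or_zero_lowest_part:
  fixes c :: "('v::finite \<Rightarrow> nat) \<Rightarrow> complex"
  assumes fin: "finite {\<alpha>. c \<alpha> \<noteq> 0}" and sz: "stable_or_zero (power_series c)"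
    and r: "\<And>\<alpha>. c \<alpha> \<noteq> 0 \<Longrightarrow> r \<le> tdeg \<alpha>"
  shows "stable_or_zero (homogeneous_part c r)"
proof -
  define A where "A = {\<alpha>. c \<alpha> \<noteq> 0}"
  have A: "finite A" using fin by (simp add: A_def)
  define \<epsilon> where "\<epsilon> = (\<lambda>n. inverse (real (Suc n)))"
  have \<epsilon>: "\<epsilon> n > 0" for n by (simp add: \<epsilon>_def)
  have "\<epsilon> \<longlonglongrightarrow> 0" unfolding \<epsilon>_def by (rule LIMSEQ_inverse_real_of_nat)
  then have \<epsilon>0: "(\<lambda>n. complex_of_real (\<epsilon> n)) \<longlonglongrightarrow> 0"
    using tendsto_of_real[of \<epsilon> 0] by simp
  \<comment> \<open>Since \<open>0 ^ 0 = 1\<close>, the power of 0 selects the terms of degree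
    exactly \<open>r\<close>.\<close>
  have "stable_or_zero (\<lambda>x. \<Sum>\<alpha>\<in>A. c \<alpha> * 0 ^ (tdeg \<alpha> - r) * Defs.monom \<alpha> x)"
  proof (rule stable_or_zero_limit_sum[OF A])
    show "(\<lambda>n. c \<alpha> * complex_of_real (\<epsilon> n) ^ (tdeg \<alpha> - r)) \<longlonglongrightarrow> c \<alpha> * 0 ^ (tdeg \<alpha> - r)" for \<alpha>
      by (intro tendsto_intros \<epsilon>0)
    show "stable_or_zero (\<lambda>x. \<Sum>\<alpha>\<in>A. c \<alpha> * complex_of_real (\<epsilon> n) ^ (tdeg \<alpha> - r) * Defs.monom \<alpha> x)" for n
    proof -
      have eq: "power_series c (complex_of_real (\<epsilon> n) *s x)
          = of_real (\<epsilon> n) ^ r * (\<Sum>\<alpha>\<in>A. c \<alpha> * complex_of_real (\<epsilon> n) ^ (tdeg \<alpha> - r) * Defs.monom \<alpha> x)" for x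
      proof -
        have "power_series c (complex_of_real (\<epsilon> n) *s x)
            = (\<Sum>\<alpha>\<in>A. c \<alpha> * (of_real (\<epsilon> n) ^ tdeg \<alpha> * Defs.monom \<alpha> x))"
          by (subst power_series_finite[OF A]) (auto simp: A_def monom_vector_scale)
        also have "\<dots> = (\<Sum>\<alpha>\<in>A. of_real (\<epsilon> n) ^ r * (c \<alpha> * complex_of_real (\<epsilon> n) ^ (tdeg \<alpha> - r) * Defs.monom \<alpha> x))"
          using r by (intro sum.cong refl) (auto simp: A_def mult_ac simp flip: power_add)
        finally show ?thesis by (simp add: sum_distrib_left)
      qed
      show ?thesis
        using sz \<epsilon>[of n] scaled_mem_upper_halfspace[OF _ \<epsilon>[of n]]
        unfolding stable_or_zero_def by (metis (no_types, lifting) eq mult_eq_0_iff of_real_eq_0_iff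
            power_not_zero less_irrefl)
    qed
  qed
  also have "(\<lambda>x. \<Sum>\<alpha>\<in>A. c \<alpha> * 0 ^ (tdeg \<alpha> - r) * Defs.monom \<alpha> x) = homogeneous_part c r"
  proof
    fix x
    have "(\<Sum>\<alpha>\<in>A. c \<alpha> * 0 ^ (tdeg \<alpha> - r) * Defs.monom \<alpha> x)
        = (\<Sum>\<alpha>\<in>A \<inter> {\<alpha>. tdeg \<alpha> = r}. c \<alpha> * Defs.monom \<alpha> x)"
      using A r by (intro sum.mono_neutral_cong_right) (auto simp: A_def power_0_left intro: antisym)
    also have "\<dots> = homogeneous_part c r x"
      unfolding homogeneous_part_def
      by (intro sum.mono_neutral_left) (auto simp: finite_tdeg_eq A_def)
    finally show "(\<Sum>\<alpha>\<in>A. c \<alpha> * 0 ^ (tdeg \<alpha> - r) * Defs.monom \<alpha> x) = homogeneous_part c r x" .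
  qed
  finally show ?thesis .
qed

text \<open>For positive real \<open>x\<close>, multiplication by t with Im t > 0 sends
  \<open>x\<close> into the half-space. After division by t^r the polynomial along this line is
  stable in t, and its coefficients are the homogeneous parts at \<open>x\<close>, starting with
  degree \<open>r\<close>.\<close>

lemma homogeneous_part_coeff_bound:
  fixes c :: "('v::finite \<Rightarrow> nat) \<Rightarrow> complex"
  assumes fin: "finite {\<alpha>. c \<alpha> \<noteq> 0}" and sz: "stable_or_zero (power_series c)"
    and r: "\<And>\<alpha>. c \<alpha> \<noteq> 0 \<Longrightarrow> r \<le> tdeg \<alpha>"
    and s: "\<And>i. s i > 0" and R: "R > 0"
  defines "x \<equiv> \<chi> i. complex_of_real (s i)"
  assumes nz: "homogeneous_part c r x \<noteq> 0"
  shows "cmod (homogeneous_part c (r + k) x) * R ^ k \<le> cmod (homogeneous_part c r x) *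
    exp (szasz_exponent (homogeneous_part c r x) (homogeneous_part c (r + 1) x) (homogeneous_part c (r + 2) x) R)"
proof -
  define A where "A = {\<alpha>. c \<alpha> \<noteq> 0}"
  have A: "finite A" using fin by (simp add: A_def)
  define N where "N = Max (insert 0 (tdeg ` A))"
  have N: "tdeg \<alpha> \<le> N" if "c \<alpha> \<noteq> 0" for \<alpha> using A that by (simp add: N_def A_def)
  define p where "p = (\<Sum>k\<le>N. Polynomial.monom (homogeneous_part c (r + k) x) k)"
  have cp: "coeff p k = homogeneous_part c (r + k) x" for k
  proof (cases "k \<le> N")
    case False
    then have "homogeneous_part c (r + k) x = 0"
      using N by (force simp: homogeneous_part_def intro!: sum.neutral)
    then show ?thesis using False by (simp add: p_def coeff_sum)
  qed (simp add: p_def coeff_sum)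
  have pp: "t ^ r * poly p t = power_series c (t *s x)" for t
  proof -
    have "t ^ r * poly p t = (\<Sum>k\<le>N. homogeneous_part c (r + k) (t *s x))"
      by (simp add: p_def poly_sum poly_monom homogeneous_part_vector_scale sum_distrib_left power_add mult_ac)
    also have "\<dots> = (\<Sum>\<alpha>\<in>(\<Union>k\<le>N. {\<alpha>. tdeg \<alpha> = r + k}). c \<alpha> * Defs.monom \<alpha> (t *s x))"
      unfolding homogeneous_part_def by (intro sum.UNION_disjoint[symmetric]) (auto simp: finite_tdeg_eq)
    also have "\<dots> = power_series c (t *s x)"
    proof (intro power_series_finite[symmetric])
      fix \<alpha> assume "c \<alpha> \<noteq> 0"
      then have "tdeg \<alpha> = r + (tdeg \<alpha> - r)" "tdeg \<alpha> - r \<le> N" using r N le_trans[OF diff_le_self] by auto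
      then show "\<alpha> \<in> (\<Union>k\<le>N. {\<alpha>. tdeg \<alpha> = r + k})" by blast
    qed (simp add: finite_tdeg_eq)
    finally show ?thesis .
  qed
  have "power_series c y \<noteq> 0" if "y \<in> upper_halfspace" for y
  proof
    assume "power_series c y = 0"
    then have "\<forall>y\<in>upper_halfspace. power_series c y = 0"
      using sz that by (auto simp: stable_or_zero_def)
    then have "c \<alpha> = 0" for \<alpha> using power_series_zero_imp_coeffs_zero[OF fin] by blast
    then show False using nz by (simp add: homogeneous_part_def)
  qed
  moreover have "t *s x \<in> upper_halfspace" if "Im t > 0" for t
    using that s by (simp add: upper_halfspace_def x_def)
  ultimately have "poly p t \<noteq> 0" if "Im t > 0" for t
    using that pp[of t] by (metis mult_zero_right)
  then show ?thesis
    using szasz_coeff_bound[of p R k] nz R by (simp add: cp)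
qed

text \<open>The point i s lies in the half-space, and by homogeneity the values at i s and at s
  differ by the factor i^r.\<close>

lemma homogeneous_part_nonzero_at_positive:
  fixes c :: "('v::finite \<Rightarrow> nat) \<Rightarrow> complex"
  assumes "stable_or_zero (homogeneous_part c r)" and "c \<alpha> \<noteq> 0" "tdeg \<alpha> = r" and s: "\<And>i. s i > 0"
  shows "homogeneous_part c r (\<chi> i. complex_of_real (s i)) \<noteq> 0"
proof -
  have "\<not> (\<forall>x\<in>upper_halfspace. homogeneous_part c r x = 0)"
  proof
    assume *: "\<forall>x\<in>upper_halfspace. homogeneous_part c r x = 0"
    have fin: "finite {\<alpha>. (if tdeg \<alpha> = r then c \<alpha> else 0) \<noteq> 0}"
      by (rule finite_subset[OF _ finite_tdeg_eq[of r]]) auto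
    have "(if tdeg \<alpha> = r then c \<alpha> else 0) = 0"
      by (rule power_series_zero_imp_coeffs_zero[OF fin, of \<alpha>])
         (use * in \<open>simp only: homogeneous_part_power_series\<close>)
    then show False using assms by simp
  qed
  moreover have "\<i> *s (\<chi> i. complex_of_real (s i)) \<in> upper_halfspace"
    using s by (simp add: upper_halfspace_def)
  ultimately have "homogeneous_part c r (\<i> *s (\<chi> i. complex_of_real (s i))) \<noteq> 0"
    using assms(1) by (auto simp: stable_or_zero_def)
  then show ?thesis by (simp add: homogeneous_part_vector_scale)
qed

lemma entire_coeffs_stable_limit:
  fixes c :: "nat \<Rightarrow> ('v::finite \<Rightarrow> nat) \<Rightarrow> complex"
  assumes fin: "\<And>n. finite {\<alpha>. c n \<alpha> \<noteq> 0}" and sz: "\<And>n. stable_or_zero (power_series (c n))"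
    and le: "\<And>n \<alpha>. cmod (c n \<alpha>) \<le> cmod (c' \<alpha>)" and lim: "\<And>\<alpha>. (\<lambda>n. c n \<alpha>) \<longlonglongrightarrow> c' \<alpha>"
  shows "entire_coeffs c'"
proof (cases "\<exists>\<alpha>. c' \<alpha> \<noteq> 0")
  case False
  then show ?thesis by (intro entire_coeffs_finite) simp
next
  case True
  define r where "r = (LEAST k. \<exists>\<alpha>. c' \<alpha> \<noteq> 0 \<and> tdeg \<alpha> = k)"
  obtain \<alpha>0 where \<alpha>0: "c' \<alpha>0 \<noteq> 0" "tdeg \<alpha>0 = r"
    using LeastI_ex[of "\<lambda>k. \<exists>\<alpha>. c' \<alpha> \<noteq> 0 \<and> tdeg \<alpha> = k"] True unfolding r_def by blast
  have r: "r \<le> tdeg \<alpha>" if "c' \<alpha> \<noteq> 0" for \<alpha>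
    unfolding r_def using that by (intro Least_le) blast
  \<comment> \<open>By domination no approximant has terms of degree below \<open>r\<close>. Its
    part of degree \<open>r\<close> may still vanish for small \<open>n\<close>, so the Szasz bound
    is available only eventually.\<close>
  have rn: "r \<le> tdeg \<alpha>" if "c n \<alpha> \<noteq> 0" for n \<alpha>
    using le[of n \<alpha>] that by (intro r) auto
  have hlim: "(\<lambda>n. homogeneous_part (c n) d x) \<longlonglongrightarrow> homogeneous_part c' d x" for d x
    unfolding homogeneous_part_def by (intro tendsto_intros lim)
  have "stable_or_zero (homogeneous_part c' r)"
    unfolding homogeneous_part_def
  proof (rule stable_or_zero_limit_sum[OF finite_tdeg_eq lim])
    show "stable_or_zero (\<lambda>x. \<Sum>\<alpha> | tdeg \<alpha> = r. c n \<alpha> * Defs.monom \<alpha> x)" for n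
      using stable_or_zero_lowest_part[OF fin sz rn] unfolding homogeneous_part_def .
  qed
  then have nz: "homogeneous_part c' r (\<chi> i. complex_of_real (s i)) \<noteq> 0" if "\<And>i. s i > 0" for s
    using \<alpha>0 that by (intro homogeneous_part_nonzero_at_positive)
  \<comment> \<open>The right side of the Szasz bound, as a function of the coefficients and the
    point: its continuity is used in the limit over \<open>n\<close> and again on the compact
    box.\<close>
  define \<Phi> where "\<Phi> = (\<lambda>(c :: ('v \<Rightarrow> nat) \<Rightarrow> complex) R x. cmod (homogeneous_part c r x) * exp (szasz_exponent (homogeneous_part c r x)
    (homogeneous_part c (r + 1) x) (homogeneous_part c (r + 2) x) R))"
  have bound: "cmod (homogeneous_part c' (r + k) (\<chi> i. complex_of_real (s i))) * R ^ k
      \<le> \<Phi> c' R (\<chi> i. complex_of_real (s i))" if s: "\<And>i. s i > 0" and R: "R > 0" for s R k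
  proof (rule tendsto_le[OF sequentially_bot])
    let ?x = "\<chi> i. complex_of_real (s i)"
    show "(\<lambda>n. \<Phi> (c n) R ?x) \<longlonglongrightarrow> \<Phi> c' R ?x"
      unfolding \<Phi>_def szasz_exponent_def by (intro tendsto_intros hlim nz s)
    show "(\<lambda>n. cmod (homogeneous_part (c n) (r + k) ?x) * R ^ k)
        \<longlonglongrightarrow> cmod (homogeneous_part c' (r + k) ?x) * R ^ k"
      by (intro tendsto_intros hlim)
    have "\<forall>\<^sub>F n in sequentially. homogeneous_part (c n) r ?x \<noteq> 0"
      by (rule tendsto_imp_eventually_ne[OF hlim nz[OF s]])
    then show "\<forall>\<^sub>F n in sequentially. cmod (homogeneous_part (c n) (r + k) ?x) * R ^ k \<le> \<Phi> (c n) R ?x"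
      unfolding \<Phi>_def
      by (rule eventually_mono) (rule homogeneous_part_coeff_bound[OF fin sz rn s R])
  qed
  define E where "E = 2 * exp (real CARD('v))"
  have E: "E > 0" by (simp add: E_def)
  \<comment> \<open>The constant \<open>B\<close> depends on \<open>R\<close>, but the rate
    \<open>E / R\<close> can be made arbitrarily small.\<close>
  have "\<exists>B\<ge>0. \<forall>\<alpha>. cmod (c' \<alpha>) \<le> B * (E / R) ^ tdeg \<alpha>" if R: "R > 0" for R
  proof -
    define box where "box = cbox ((\<chi> i. 1) :: real ^ 'v) (\<chi> i. 2)"
    define cx where "cx = (\<lambda>v :: real ^ 'v. \<chi> i. complex_of_real (v $ i))"
    have hc: "continuous_on S (\<lambda>v. homogeneous_part c' d (cx v))" for S d
      unfolding homogeneous_part_def Defs.monom_def cx_def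
      by (simp, intro continuous_intros)
    have nzb: "homogeneous_part c' r (cx v) \<noteq> 0" if "v \<in> box" for v
    proof -
      have "v $ i > 0" for i
        using that by (auto simp: box_def mem_box_cart dest!: spec[of _ i])
      then show ?thesis unfolding cx_def by (rule nz)
    qed
    have "continuous_on box (\<lambda>v. \<Phi> c' R (cx v))"
      unfolding \<Phi>_def szasz_exponent_def by (intro continuous_intros hc ballI nzb)
    moreover have "compact box" by (simp add: box_def)
    ultimately have "bounded ((\<lambda>v. \<Phi> c' R (cx v)) ` box)"
      by (intro compact_imp_bounded compact_continuous_image)
    then obtain B0 where B0: "B0 > 0" "\<And>v. v \<in> box \<Longrightarrow> \<bar>\<Phi> c' R (cx v)\<bar> \<le> B0"
      unfolding bounded_pos by auto
    \<comment> \<open>The Szasz bound gains \<open>R ^ k\<close> with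
      \<open>k = tdeg \<alpha> - r\<close>; the factor \<open>R ^ r\<close> restores the full
      exponent.\<close>
    have "cmod (c' \<alpha>) \<le> B0 * R ^ r * (E / R) ^ tdeg \<alpha>" for \<alpha>
    proof (cases "c' \<alpha> = 0")
      case False
      define k where "k = tdeg \<alpha> - r"
      have k: "tdeg \<alpha> = r + k" using r[OF False] by (simp add: k_def)
      have "cmod (c' \<alpha>) \<le> (B0 / R ^ k) * (2 * exp (real CARD('v))) ^ tdeg \<alpha>"
      proof (rule homogeneous_coeff_bound)
        fix s :: "'v \<Rightarrow> real" assume s: "\<And>i. 1 \<le> s i \<and> s i \<le> 2"
        then have s0: "s i > 0" for i using less_le_trans[of 0 1 "s i"] by simp
        have "(\<chi> i. s i) \<in> box" using s by (simp add: box_def mem_box_cart)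
        from B0(2)[OF this] bound[of s R k, OF s0 R] R
        show "cmod (homogeneous_part c' (tdeg \<alpha>) (\<chi> i. complex_of_real (s i))) \<le> B0 / R ^ k"
          by (simp add: cx_def k field_simps)
      qed
      also have "\<dots> = B0 * R ^ r * (E / R) ^ tdeg \<alpha>"
        using R by (simp add: E_def k power_add power_divide field_simps)
      finally show ?thesis .
    qed (use B0 R E in auto)
    then show ?thesis using B0 R by (intro exI[of _ "B0 * R ^ r"]) auto
  qed
  note bd = this
  show ?thesis
    unfolding entire_coeffs_def
  proof (intro allI impI)
    fix \<rho> :: real assume \<rho>: "\<rho> \<ge> 0"
    \<comment> \<open>This makes \<open>E / R * \<rho>\<close> at most 1/2; the summand 1 keeps
      \<open>R\<close> positive when \<rho> = 0.\<close>
    define R where "R = 2 * E * (\<rho> + 1)"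
    have R: "R > 0" using E \<rho> by (simp add: R_def)
    obtain B where B: "B \<ge> 0" "\<And>\<alpha>. cmod (c' \<alpha>) \<le> B * (E / R) ^ tdeg \<alpha>" using bd[OF R] by blast
    have eq: "E / R * \<rho> = \<rho> / (2 * (\<rho> + 1))" using E by (simp add: R_def)
    have q: "E / R * \<rho> \<le> 1 / 2" "E / R * \<rho> \<ge> 0"
      unfolding eq using \<rho> by (simp_all add: field_simps)
    have "(\<lambda>\<alpha>. B * (1 / 2) ^ tdeg \<alpha>) summable_on (UNIV :: ('v \<Rightarrow> nat) set)"
      by (intro summable_on_cmult_right summable_on_power_tdeg) auto
    then show "(\<lambda>\<alpha>. cmod (c' \<alpha>) * \<rho> ^ tdeg \<alpha>) summable_on UNIV"
    proof (rule summable_on_comparison_test)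
      fix \<alpha> :: "'v \<Rightarrow> nat"
      have "cmod (c' \<alpha>) * \<rho> ^ tdeg \<alpha> \<le> B * (E / R) ^ tdeg \<alpha> * \<rho> ^ tdeg \<alpha>"
        using B(2) \<rho> by (intro mult_right_mono) auto
      also have "\<dots> = B * (E / R * \<rho>) ^ tdeg \<alpha>" by (simp only: power_mult_distrib mult.assoc)
      also have "\<dots> \<le> B * (1 / 2) ^ tdeg \<alpha>"
        using q B(1) by (intro mult_left_mono power_mono) auto
      finally show "cmod (c' \<alpha>) * \<rho> ^ tdeg \<alpha> \<le> B * (1 / 2) ^ tdeg \<alpha>" .
    qed (use \<rho> in auto)
  qed
qed

section \<open>Truncations\<close>

lemma falling_Suc: "falling b (Suc l) = falling b l * (b - l)"
proof -
  consider "l < b" | "l = b" | "l > b" by linarith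
  then show ?thesis
  proof cases
    case 1
    then have "fact (b - l) = (b - l) * (fact (b - Suc l) :: nat)"
      by (metis Suc_diff_Suc fact_Suc of_nat_id)
    moreover have "falling b m * fact (b - m) = fact b" if "m \<le> b" for m
      using that by (simp add: falling_def fact_dvd)
    from this[of l] this[of "Suc l"] have "falling b l * fact (b - l) = falling b (Suc l) * fact (b - Suc l)"
      using 1 by simp
    ultimately have "falling b l * (b - l) * fact (b - Suc l) = falling b (Suc l) * (fact (b - Suc l) :: nat)"
      by (simp add: mult.assoc)
    then show ?thesis by simp
  qed (auto simp: falling_def)
qed

lemma falling_le: "falling b l \<le> fact b"
  by (simp add: falling_def)

text \<open>Each increment of \<open>l\<close> multiplies the ratio by (b - l)/b, which is at most
  1. This yields the domination of the rescaled truncations.\<close>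

lemma falling_ratio_le_1: "real (falling b l) / real b ^ l \<le> 1"
proof (induction l)
  case 0
  then show ?case by (simp add: falling_def)
next
  case (Suc l)
  have "real (falling b (Suc l)) / real b ^ Suc l = real (falling b l) / real b ^ l * (real (b - l) / real b)"
    by (simp add: falling_Suc)
  also have "\<dots> \<le> 1 * 1"
    using Suc.IH by (intro mult_mono) (auto simp: divide_le_eq)
  finally show ?case by simp
qed

lemma falling_ratio_tendsto: "(\<lambda>k. real (falling (Suc k) l) / real (Suc k) ^ l) \<longlonglongrightarrow> 1"
proof (induction l)
  case 0
  then show ?case by (simp add: falling_def)
next
  case (Suc l)
  have "(\<lambda>k. 1 - real l * inverse (real (Suc k))) \<longlonglongrightarrow> 1 - real l * 0"
    by (intro tendsto_intros LIMSEQ_inverse_real_of_nat)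
  moreover have "\<forall>\<^sub>F k in sequentially. 1 - real l * inverse (real (Suc k)) = real (Suc k - l) / real (Suc k)"
    using eventually_ge_at_top[of l] by eventually_elim (simp add: of_nat_diff field_simps)
  ultimately have "(\<lambda>k. real (Suc k - l) / real (Suc k)) \<longlonglongrightarrow> 1 - real l * 0"
    by (rule Lim_transform_eventually)
  then have "(\<lambda>k. real (Suc k - l) / real (Suc k)) \<longlonglongrightarrow> 1" by simp
  from tendsto_mult[OF Suc.IH this] show ?case by (simp add: falling_Suc mult.commute)
qed

lemma norm_vec_le_of_components:
  fixes x :: "complex ^ 'v::finite"
  assumes "\<And>i. cmod (x $ i) \<le> R"
  shows "norm x \<le> real CARD('v) * R"
proof -
  have "norm x \<le> (\<Sum>i\<in>UNIV. cmod (x $ i))"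
    unfolding norm_vec_def by (rule L2_set_le_sum) simp
  also have "\<dots> \<le> (\<Sum>i\<in>(UNIV :: 'v set). R)" by (intro sum_mono assms)
  finally show ?thesis by simp
qed

text \<open>Multiplying coefficients is not an operation on values, so the closeness is first passed
  to the coefficients: a Cauchy estimate at radius 2\<rho> bounds their weighted differences at
  radius \<rho> by \<epsilon> 2^(-|\<alpha>|), which is summable and unharmed by a bounded
  \<mu>.\<close>

lemma multiplier_uniform_limit:
  fixes c :: "('v::finite \<Rightarrow> nat) \<Rightarrow> complex" and \<mu> :: "('v \<Rightarrow> nat) \<Rightarrow> complex"
  assumes b: "\<And>k. entire_coeffs (b k)" and c: "entire_coeffs c"
    and lim: "\<And>S. compact S \<Longrightarrow> uniform_limit S (\<lambda>k. power_series (b k)) (power_series c) sequentially"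
    and \<mu>: "\<And>\<alpha>. cmod (\<mu> \<alpha>) \<le> C" and S: "compact S"
  shows "uniform_limit S (\<lambda>k. power_series (\<lambda>\<alpha>. \<mu> \<alpha> * b k \<alpha>)) (power_series (\<lambda>\<alpha>. \<mu> \<alpha> * c \<alpha>)) sequentially"
proof (rule uniform_limitI)
  fix e :: real assume e: "e > 0"
  obtain \<rho> where \<rho>: "\<rho> > 0" "\<And>x. x \<in> S \<Longrightarrow> norm x \<le> \<rho>"
    using compact_imp_bounded[OF S] bounded_pos by blast
  have C: "C \<ge> 0" using \<mu> norm_ge_zero order_trans by blast
  define G where "G = (\<Sum>\<^sub>\<infinity>\<alpha>\<in>(UNIV :: ('v \<Rightarrow> nat) set). (1 / 2 :: real) ^ tdeg \<alpha>)"
  have sG: "(\<lambda>\<alpha> :: 'v \<Rightarrow> nat. (1 / 2 :: real) ^ tdeg \<alpha>) summable_on UNIV"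
    by (rule summable_on_power_tdeg) auto
  have G: "G \<ge> 0" unfolding G_def by (rule infsum_nonneg) simp
  \<comment> \<open>The total error will be \<open>C * \<epsilon> * G\<close>; the summand 1 covers
    the case \<open>C * G = 0\<close>.\<close>
  define \<epsilon> where "\<epsilon> = e / (C * G + 1)"
  have \<epsilon>: "\<epsilon> > 0" and \<epsilon>e: "C * \<epsilon> * G < e"
  proof -
    have pos: "C * G + 1 > 0" using C G by (intro add_nonneg_pos) auto
    then show "\<epsilon> > 0" using e by (simp add: \<epsilon>_def)
    have "C * \<epsilon> * G = e * (C * G / (C * G + 1))" by (simp add: \<epsilon>_def)
    also have "\<dots> < e * 1" using e pos by (intro mult_strict_left_mono) auto
    finally show "C * \<epsilon> * G < e" by simp
  qed
  have ent: "entire_coeffs (\<lambda>\<alpha>. b k \<alpha> - c \<alpha>)"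
    and ps: "power_series (\<lambda>\<alpha>. b k \<alpha> - c \<alpha>) x = power_series (b k) x - power_series c x" for k x
  proof -
    have hs: "((\<lambda>\<alpha>. (b k \<alpha> - c \<alpha>) * Defs.monom \<alpha> x) has_sum (power_series (b k) x - power_series c x)) UNIV" for x
      using has_sum_add[OF has_sum_infsum[OF summable_on_power_series[OF b]]
          has_sum_uminusI[OF has_sum_infsum[OF summable_on_power_series[OF c]]], of k x x]
      by (simp add: power_series_def algebra_simps)
    then show "entire_coeffs (\<lambda>\<alpha>. b k \<alpha> - c \<alpha>)"
      by (intro has_coeffs_imp_entire(1)[of "\<lambda>x. power_series (b k) x - power_series c x"])
         (simp add: has_coeffs_def)
    show "power_series (\<lambda>\<alpha>. b k \<alpha> - c \<alpha>) x = power_series (b k) x - power_series c x"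
      unfolding power_series_def[of "\<lambda>\<alpha>. b k \<alpha> - c \<alpha>"] using hs by (rule infsumI)
  qed
  have "\<forall>\<^sub>F k in sequentially. \<forall>x\<in>cball 0 (real CARD('v) * (2 * \<rho>)). dist (power_series (b k) x) (power_series c x) < \<epsilon>"
    by (rule uniform_limitD[OF lim \<epsilon>]) simp
  then show "\<forall>\<^sub>F k in sequentially. \<forall>x\<in>S. dist (power_series (\<lambda>\<alpha>. \<mu> \<alpha> * b k \<alpha>) x) (power_series (\<lambda>\<alpha>. \<mu> \<alpha> * c \<alpha>) x) < e"
  proof eventually_elim
    case (elim k)
    \<comment> \<open>The radius of the ball was chosen so that it contains the torus on which all
      coordinates have modulus 2\<rho>.\<close>
    have cb: "cmod (b k \<alpha> - c \<alpha>) * (2 * \<rho>) ^ tdeg \<alpha> \<le> \<epsilon>" for \<alpha>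
    proof (rule Cauchy_bound[OF ent])
      fix x :: "complex ^ 'v" assume "\<And>i. cmod (x $ i) = 2 * \<rho>"
      then have "x \<in> cball 0 (real CARD('v) * (2 * \<rho>))"
        using norm_vec_le_of_components[of x "2 * \<rho>"] by simp
      then show "cmod (power_series (\<lambda>\<alpha>. b k \<alpha> - c \<alpha>) x) \<le> \<epsilon>"
        using elim by (auto simp: ps dist_norm intro: less_imp_le)
    qed (use \<rho> in simp)
    have term_bd: "cmod (\<mu> \<alpha> * (b k \<alpha> - c \<alpha>)) * \<rho> ^ tdeg \<alpha> \<le> C * \<epsilon> * (1 / 2) ^ tdeg \<alpha>" for \<alpha>
    proof -
      have "cmod (b k \<alpha> - c \<alpha>) * \<rho> ^ tdeg \<alpha> \<le> \<epsilon> * (1 / 2) ^ tdeg \<alpha>"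
        using cb[of \<alpha>] by (simp add: power_mult_distrib power_one_over field_simps)
      then have "cmod (\<mu> \<alpha>) * (cmod (b k \<alpha> - c \<alpha>) * \<rho> ^ tdeg \<alpha>) \<le> C * (\<epsilon> * (1 / 2) ^ tdeg \<alpha>)"
        using C \<rho> by (intro mult_mono[OF \<mu>]) auto
      then show ?thesis by (simp add: norm_mult mult.assoc)
    qed
    show ?case
    proof
      fix x assume x: "x \<in> S"
      let ?d = "\<lambda>\<alpha>. \<mu> \<alpha> * (b k \<alpha> - c \<alpha>) * Defs.monom \<alpha> x"
      have entm: "entire_coeffs (\<lambda>\<alpha>. \<mu> \<alpha> * h \<alpha>)" if h: "entire_coeffs h" for h
        unfolding entire_coeffs_def
      proof (intro allI impI)
        fix \<rho> :: real assume \<rho>: "\<rho> \<ge> 0"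
        have "(\<lambda>\<alpha>. C * (cmod (h \<alpha>) * \<rho> ^ tdeg \<alpha>)) summable_on UNIV"
          using h \<rho> by (intro summable_on_cmult_right) (auto simp: entire_coeffs_def)
        then show "(\<lambda>\<alpha>. cmod (\<mu> \<alpha> * h \<alpha>) * \<rho> ^ tdeg \<alpha>) summable_on UNIV"
        proof (rule summable_on_comparison_test)
          show "cmod (\<mu> \<alpha> * h \<alpha>) * \<rho> ^ tdeg \<alpha> \<le> C * (cmod (h \<alpha>) * \<rho> ^ tdeg \<alpha>)" for \<alpha>
            unfolding norm_mult mult.assoc using \<rho> by (intro mult_right_mono \<mu>) simp
        qed (use \<rho> in simp)
      qed
      have "(?d has_sum (power_series (\<lambda>\<alpha>. \<mu> \<alpha> * b k \<alpha>) x - power_series (\<lambda>\<alpha>. \<mu> \<alpha> * c \<alpha>) x)) UNIV"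
        using has_sum_add[OF has_sum_infsum[OF summable_on_power_series[OF entm[OF b]]]
            has_sum_uminusI[OF has_sum_infsum[OF summable_on_power_series[OF entm[OF c]]]], of k x x]
        by (simp add: power_series_def algebra_simps)
      moreover have "((\<lambda>\<alpha>. C * \<epsilon> * (1 / 2) ^ tdeg \<alpha>) has_sum (C * \<epsilon> * G)) (UNIV :: ('v \<Rightarrow> nat) set)"
        unfolding G_def by (intro has_sum_cmult_right has_sum_infsum sG)
      moreover have "cmod (?d \<alpha>) \<le> C * \<epsilon> * (1 / 2) ^ tdeg \<alpha>" for \<alpha>
      proof -
        have "cmod (Defs.monom \<alpha> x) \<le> \<rho> ^ tdeg \<alpha>"
          using \<rho>(2)[OF x] by (intro norm_monom_le order_trans[OF Finite_Cartesian_Product.norm_nth_le])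
        then have "cmod (\<mu> \<alpha> * (b k \<alpha> - c \<alpha>)) * cmod (Defs.monom \<alpha> x)
            \<le> cmod (\<mu> \<alpha> * (b k \<alpha> - c \<alpha>)) * \<rho> ^ tdeg \<alpha>"
          by (intro mult_left_mono) auto
        then show ?thesis
          unfolding norm_mult[of "\<mu> \<alpha> * (b k \<alpha> - c \<alpha>)"] using term_bd by (rule order_trans)
      qed
      ultimately have "cmod (power_series (\<lambda>\<alpha>. \<mu> \<alpha> * b k \<alpha>) x - power_series (\<lambda>\<alpha>. \<mu> \<alpha> * c \<alpha>) x) \<le> C * \<epsilon> * G"
        by (rule norm_infsum_le)
      then show "dist (power_series (\<lambda>\<alpha>. \<mu> \<alpha> * b k \<alpha>) x) (power_series (\<lambda>\<alpha>. \<mu> \<alpha> * c \<alpha>) x) < e"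
        using \<epsilon>e by (simp add: dist_norm)
    qed
  qed
qed

section \<open>Truncations as power series in all variables\<close>

lemma is_poly_iff_power_series:
  "is_poly K p \<longleftrightarrow> (\<exists>c. finite {\<alpha>. c \<alpha> \<noteq> 0} \<and> (\<forall>\<alpha>. c \<alpha> \<in> K) \<and> p = power_series c)"
proof -
  have "(\<forall>x. p x = (\<Sum>\<alpha>\<in>{\<alpha>. c \<alpha> \<noteq> 0}. c \<alpha> * Defs.monom \<alpha> x)) \<longleftrightarrow> p = power_series c"
    if "finite {\<alpha>. c \<alpha> \<noteq> 0}" for c
    using power_series_finite[OF that, of c] by (auto simp: fun_eq_iff)
  then show ?thesis unfolding is_poly_def by blast
qed

lemma ffact_multi_eq_prod_falling: "ffact_multi \<beta> \<alpha> = (\<Prod>i\<in>UNIV. falling (\<beta> i) (\<alpha> i))"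
proof (cases "\<alpha> \<le> \<beta>")
  case True
  then show ?thesis by (auto simp: ffact_multi_def falling_def le_fun_def intro!: prod.cong)
next
  case False
  then obtain i where "\<not> \<alpha> i \<le> \<beta> i" by (auto simp: le_fun_def)
  then have "(\<Prod>i\<in>UNIV. falling (\<beta> i) (\<alpha> i)) = 0"
    by (intro prod_zero) (auto simp: falling_def intro!: exI[of _ i])
  then show ?thesis using False by (simp add: ffact_multi_def)
qed

lemma monom_case_sum:
  "Defs.monom (case_sum \<gamma> \<alpha>) x = Defs.monom \<gamma> (zpart x) * Defs.monom \<alpha> (wpart x)"
  unfolding Defs.monom_def zpart_def wpart_def UNIV_Plus_UNIV[symmetric]
  by (subst prod.Plus) auto

text \<open>These are the coefficients of \<open>trunc_poly a \<beta>\<close> in all variables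
  jointly; the restriction to \<alpha> \<le> \<beta> is encoded in the vanishing of the
  multiplier.\<close>

definition trunc_coeff ::
  "(('n::finite \<Rightarrow> nat) \<Rightarrow> ('n \<Rightarrow> nat) \<Rightarrow> complex) \<Rightarrow> ('n \<Rightarrow> nat) \<Rightarrow> ('n + 'n \<Rightarrow> nat) \<Rightarrow> complex" where
  "trunc_coeff a \<beta> \<delta> = of_nat (\<Prod>i\<in>UNIV. falling (\<beta> i) (\<delta> (Inr i))) * joint_coeff a \<delta>"

lemma trunc_poly_power_series:
  fixes a :: "('n::finite \<Rightarrow> nat) \<Rightarrow> ('n \<Rightarrow> nat) \<Rightarrow> complex"
  assumes a_poly: "\<And>\<alpha>. finite {\<gamma>. a \<gamma> \<alpha> \<noteq> 0}"
  shows "finite {\<delta>. trunc_coeff a \<beta> \<delta> \<noteq> 0}" and "trunc_poly a \<beta> = power_series (trunc_coeff a \<beta>)"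
proof -
  define B where "B = (SIGMA \<alpha>:{\<alpha>. \<alpha> \<le> \<beta>}. {\<gamma>. a \<gamma> \<alpha> \<noteq> 0})"
  define \<iota> where "\<iota> = (\<lambda>(\<alpha> :: 'n \<Rightarrow> nat, \<gamma> :: 'n \<Rightarrow> nat). case_sum \<gamma> \<alpha>)"
  have "finite {\<alpha>. \<alpha> \<le> \<beta>}" using finite_bounded_multiindices[of \<beta>] by (simp add: le_fun_def)
  then have B: "finite B" unfolding B_def using a_poly by blast
  have inj: "inj_on \<iota> B"
    by (auto simp: inj_on_def \<iota>_def fun_eq_iff split: sum.splits)
  have supp: "\<delta> \<in> \<iota> ` B" if nz: "trunc_coeff a \<beta> \<delta> \<noteq> 0" for \<delta>
  proof -
    have "\<delta> (Inr i) \<le> \<beta> i" for i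
      using nz by (force simp: trunc_coeff_def falling_def prod_zero_iff split: if_splits)
    then have "(\<delta> \<circ> Inr, \<delta> \<circ> Inl) \<in> B"
      using nz by (auto simp: B_def le_fun_def trunc_coeff_def joint_coeff_def)
    moreover have "\<delta> = \<iota> (\<delta> \<circ> Inr, \<delta> \<circ> Inl)"
      by (auto simp: \<iota>_def fun_eq_iff split: sum.splits)
    ultimately show ?thesis by blast
  qed
  then show "finite {\<delta>. trunc_coeff a \<beta> \<delta> \<noteq> 0}" by (intro finite_subset[OF _ finite_imageI[OF B]]) auto
  show "trunc_poly a \<beta> = power_series (trunc_coeff a \<beta>)"
  proof
    fix x :: "complex ^ ('n + 'n)"
    have "power_series (trunc_coeff a \<beta>) x
        = (\<Sum>\<delta>\<in>\<iota> ` B. trunc_coeff a \<beta> \<delta> * Defs.monom \<delta> x)"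
      using supp by (intro power_series_finite finite_imageI B)
    also have "\<dots> = (\<Sum>(\<alpha>, \<gamma>)\<in>B. of_nat (ffact_multi \<beta> \<alpha>) * (a \<gamma> \<alpha> * Defs.monom \<gamma> (zpart x)) * Defs.monom \<alpha> (wpart x))"
      unfolding sum.reindex[OF inj]
      by (intro sum.cong refl)
         (auto simp: \<iota>_def trunc_coeff_def joint_coeff_def monom_case_sum ffact_multi_eq_prod_falling comp_def)
    also have "\<dots> = trunc_poly a \<beta> x"
      unfolding B_def trunc_poly_def Pcoef_def sum_distrib_left sum_distrib_right
      using \<open>finite {\<alpha>. \<alpha> \<le> \<beta>}\<close> a_poly by (subst sum.Sigma) auto
    finally show "trunc_poly a \<beta> x = power_series (trunc_coeff a \<beta>) x" ..
  qed
qed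

text \<open>A polynomial that vanishes on the half-space has only zero coefficients, so the zero
  alternative gives the zero function everywhere.\<close>

lemma mem_Hstab_or_zero_iff:
  fixes c :: "('v::finite \<Rightarrow> nat) \<Rightarrow> complex"
  assumes "finite {\<alpha>. c \<alpha> \<noteq> 0}" and "\<And>\<alpha>. c \<alpha> \<in> K"
  shows "power_series c \<in> Hstab K \<union> {\<lambda>x. 0} \<longleftrightarrow> stable_or_zero (power_series c)"
proof
  assume "stable_or_zero (power_series c)"
  then consider "\<forall>x\<in>upper_halfspace. power_series c x \<noteq> 0" | "\<forall>x\<in>upper_halfspace. power_series c x = 0"
    by (auto simp: stable_or_zero_def)
  then show "power_series c \<in> Hstab K \<union> {\<lambda>x. 0}"
  proof cases
    case 1
    then show ?thesis
      using assms by (auto simp: Hstab_def is_poly_iff_power_series upper_halfspace_def)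
  next
    case 2
    then have "c = (\<lambda>_. 0)" using power_series_zero_imp_coeffs_zero[OF assms(1)] by blast
    then have "power_series c = (\<lambda>x. 0)" by (simp add: power_series_def fun_eq_iff)
    then show ?thesis by simp
  qed
qed (auto simp: Hstab_def stable_or_zero_def upper_halfspace_def)

section \<open>The two implications between limits and truncations\<close>

lemma Hbar_imp_trunc_stable:
  fixes a :: "('n::finite \<Rightarrow> nat) \<Rightarrow> ('n \<Rightarrow> nat) \<Rightarrow> complex"
  assumes "fps_in (joint_coeff a) (Hbar K)"
  shows "stable_or_zero (power_series (trunc_coeff a \<beta>))"
proof -
  define c where "c = joint_coeff a"
  obtain f where f: "has_coeffs f c" "f \<in> Hbar K" using assms unfolding fps_in_def c_def by blast
  note c = has_coeffs_imp_entire[OF f(1)]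
  obtain ps where ps: "\<And>k. ps k \<in> Hstab UNIV"
      "\<And>S. compact S \<Longrightarrow> uniform_limit S ps f sequentially"
    using f(2) unfolding Hbar_def by blast
  have "\<forall>k. \<exists>b. finite {\<alpha>. b \<alpha> \<noteq> 0} \<and> ps k = power_series b"
    using ps(1) by (auto simp: Hstab_def is_poly_iff_power_series)
  from choice[OF this] obtain b where b: "\<And>k. finite {\<alpha>. b k \<alpha> \<noteq> 0}" "\<And>k. ps k = power_series (b k)"
    by blast
  have psb: "ps = (\<lambda>k. power_series (b k))" using b(2) by (rule ext)
  define \<beta>' :: "'n + 'n \<Rightarrow> nat" where "\<beta>' = case_sum (\<lambda>_. 0) \<beta>"
  \<comment> \<open>Taking the product over \<open>range Inr\<close> leaves the z-variables
    untouched. The multiplier is bounded by the product of the \<open>fact (\<beta> i)\<close>, as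
    the passage to the limit requires.\<close>
  define \<mu> :: "('n + 'n \<Rightarrow> nat) \<Rightarrow> complex" where "\<mu> = (\<lambda>\<delta>. of_nat (\<Prod>j\<in>range Inr. falling (\<beta>' j) (\<delta> j)))"
  have \<mu>: "\<mu> \<delta> = of_nat (\<Prod>i\<in>UNIV. falling (\<beta> i) (\<delta> (Inr i)))" for \<delta>
    unfolding \<mu>_def by (subst prod.reindex) (auto simp: \<beta>'_def)
  have fin: "finite {\<delta>. \<mu> \<delta> * b k \<delta> \<noteq> 0}" for k
    by (rule finite_subset[OF _ b(1)]) auto
  have "stable_or_zero (power_series (\<lambda>\<delta>. \<mu> \<delta> * c \<delta>))"
  proof (rule stable_or_zero_limit)
    fix S :: "(complex ^ ('n + 'n)) set" assume S: "compact S"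
    show "uniform_limit S (\<lambda>k. power_series (\<lambda>\<delta>. \<mu> \<delta> * b k \<delta>)) (power_series (\<lambda>\<delta>. \<mu> \<delta> * c \<delta>)) sequentially"
    proof (rule multiplier_uniform_limit[OF entire_coeffs_finite[OF b(1)] c(1) _ _ S])
      show "uniform_limit T (\<lambda>k. power_series (b k)) (power_series c) sequentially" if "compact T" for T
        using ps(2)[OF that] unfolding psb c(2) .
      show "cmod (\<mu> \<delta>) \<le> real (\<Prod>i\<in>UNIV. fact (\<beta> i))" for \<delta>
        unfolding \<mu> norm_of_nat of_nat_le_iff by (intro prod_mono) (auto intro: falling_le)
    qed
  next
    fix k and x y :: "complex ^ ('n + 'n)"
    have "power_series (\<lambda>\<delta>. \<mu> \<delta> * b k \<delta>) z
        = (\<Sum>\<delta>\<in>{\<delta>. \<mu> \<delta> * b k \<delta> \<noteq> 0}. \<mu> \<delta> * b k \<delta> * Defs.monom \<delta> z)" for z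
      by (rule power_series_finite[OF fin]) auto
    then show "(\<lambda>t. power_series (\<lambda>\<delta>. \<mu> \<delta> * b k \<delta>) (x + t *s y)) holomorphic_on UNIV"
      by (simp only:) (intro holomorphic_intros holomorphic_monom_line)
  next
    fix k
    have "stable_or_zero (power_series (b k))"
      using ps(1)[of k] unfolding b(2) by (auto simp: Hstab_def stable_or_zero_def upper_halfspace_def)
    then show "stable_or_zero (power_series (\<lambda>\<delta>. \<mu> \<delta> * b k \<delta>))"
      unfolding \<mu>_def by (rule stable_or_zero_falling_multipliers[OF b(1)])
  qed
  also have "(\<lambda>\<delta>. \<mu> \<delta> * c \<delta>) = trunc_coeff a \<beta>"
    by (simp add: fun_eq_iff \<mu> trunc_coeff_def c_def)
  finally show ?thesis .
qed

text \<open>The polynomials \<open>trunc_poly a (k, \<dots>, k)\<close> at \<open>(z, w/k)\<close> converge coefficientwise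
  to the given series.\<close>
lemma trunc_stable_imp_Hbar:
  fixes a :: "('n::finite \<Rightarrow> nat) \<Rightarrow> ('n \<Rightarrow> nat) \<Rightarrow> complex"
  assumes a_K: "\<And>\<gamma> \<alpha>. a \<gamma> \<alpha> \<in> K" and fin: "\<And>\<beta>. finite {\<delta>. trunc_coeff a \<beta> \<delta> \<noteq> 0}"
    and sz: "\<And>\<beta>. stable_or_zero (power_series (trunc_coeff a \<beta>))"
  shows "fps_in (joint_coeff a) (Hbar K)"
proof -
  define c where "c = joint_coeff a"
  \<comment> \<open>The factor that remains after rescaling w. Each of its ratios lies in [0,1] and
    tends to 1; \<open>Suc k\<close> avoids division by 0.\<close>
  define lam :: "nat \<Rightarrow> ('n + 'n \<Rightarrow> nat) \<Rightarrow> real" where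
    "lam = (\<lambda>k \<delta>. \<Prod>i\<in>UNIV. real (falling (Suc k) (\<delta> (Inr i))) / real (Suc k) ^ \<delta> (Inr i))"
  define b where "b = (\<lambda>k \<delta>. complex_of_real (lam k \<delta>) * c \<delta>)"
  have b_eq: "b k \<delta> = trunc_coeff a (\<lambda>_. Suc k) \<delta> / (\<Prod>i\<in>UNIV. of_nat (Suc k) ^ \<delta> (Inr i))" for k \<delta>
    by (simp add: b_def lam_def trunc_coeff_def c_def prod_dividef del: of_nat_Suc)
  have bfin: "finite {\<delta>. b k \<delta> \<noteq> 0}" for k
    by (rule finite_subset[OF _ fin[of "\<lambda>_. Suc k"]]) (auto simp: b_eq)
  have bsz: "stable_or_zero (power_series (b k))" for k
  proof -
    \<comment> \<open>Dividing the w-coordinates by a positive number maps the half-space into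
      itself, so the rescaled truncation inherits the alternative.\<close>
    define \<sigma> :: "complex ^ ('n + 'n) \<Rightarrow> complex ^ ('n + 'n)" where
      "\<sigma> = (\<lambda>x. \<chi> j. case j of Inl i \<Rightarrow> x $ j | Inr i \<Rightarrow> x $ j / of_nat (Suc k))"
    have "Defs.monom \<delta> (\<sigma> x) = Defs.monom \<delta> x / (\<Prod>i\<in>UNIV. of_nat (Suc k) ^ \<delta> (Inr i))" for \<delta> x
      unfolding Defs.monom_def UNIV_Plus_UNIV[symmetric]
      by (simp add: \<sigma>_def prod.Plus power_divide prod_dividef del: of_nat_Suc UNIV_Plus_UNIV)
    then have "power_series (b k) x = power_series (trunc_coeff a (\<lambda>_. Suc k)) (\<sigma> x)" for x
      unfolding power_series_def b_eq by simp
    moreover have "\<sigma> x \<in> upper_halfspace" if "x \<in> upper_halfspace" for x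
      using that by (auto simp: \<sigma>_def upper_halfspace_def split: sum.split simp del: of_nat_Suc)
    ultimately show ?thesis
      using sz[of "\<lambda>_. Suc k"] by (auto simp: stable_or_zero_def)
  qed
  have lam01: "0 \<le> lam k \<delta>" "lam k \<delta> \<le> 1" for k \<delta>
    unfolding lam_def using falling_ratio_le_1
    by (auto intro!: prod_nonneg prod_le_1 simp del: of_nat_Suc)
  have ble: "cmod (b k \<delta>) \<le> cmod (c \<delta>)" for k \<delta>
    using lam01[of k \<delta>] by (simp add: b_def norm_mult mult_left_le_one_le)
  have blim: "(\<lambda>k. b k \<delta>) \<longlonglongrightarrow> c \<delta>" for \<delta>
  proof -
    have "(\<lambda>k. lam k \<delta>) \<longlonglongrightarrow> (\<Prod>i\<in>(UNIV :: 'n set). 1)"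
      unfolding lam_def by (intro tendsto_prod falling_ratio_tendsto)
    then have "(\<lambda>k. complex_of_real (lam k \<delta>) * c \<delta>) \<longlonglongrightarrow> complex_of_real 1 * c \<delta>"
      by (intro tendsto_intros) simp
    then show ?thesis by (simp add: b_def)
  qed
  have ent: "entire_coeffs c"
    by (rule entire_coeffs_stable_limit[OF bfin bsz ble blim])
  have "\<exists>ps. (\<forall>k. ps k \<in> Hstab UNIV) \<and> (\<forall>S. compact S \<longrightarrow> uniform_limit S ps (power_series c) sequentially)"
  proof (cases "\<exists>\<delta>. c \<delta> \<noteq> 0")
    case True
    then obtain \<delta> where "c \<delta> \<noteq> 0" by blast
    \<comment> \<open>\<open>Hstab\<close> excludes the zero polynomial, so the initial
      approximants, which might be zero, are dropped.\<close>
    from tendsto_imp_eventually_ne[OF blim this] obtain N where N: "\<And>k. k \<ge> N \<Longrightarrow> b k \<delta> \<noteq> 0"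
      by (auto simp: eventually_sequentially)
    show ?thesis
    proof (intro exI conjI allI impI)
      fix k
      have "power_series (b (k + N)) \<in> Hstab UNIV \<union> {\<lambda>x. 0}"
        using bsz by (subst mem_Hstab_or_zero_iff[OF bfin]) auto
      moreover have "power_series (b (k + N)) \<noteq> (\<lambda>x. 0)"
        using power_series_zero_imp_coeffs_zero[OF bfin, of "k + N" \<delta>] N[of "k + N"] by auto
      ultimately show "power_series (b (k + N)) \<in> Hstab UNIV" by simp
    next
      fix S :: "(complex ^ ('n + 'n)) set" assume S: "compact S"
      show "uniform_limit S (\<lambda>k. power_series (b (k + N))) (power_series c) sequentially"
        using ble ent S
        by (intro power_series_uniform_limit[where g = "\<lambda>\<delta>. cmod (c \<delta>)"] LIMSEQ_ignore_initial_segment blim)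
           (auto simp: entire_coeffs_def)
    qed
  next
    case False
    then have c0: "power_series c = (\<lambda>x. 0)" by (simp add: power_series_def fun_eq_iff)
    \<comment> \<open>For the zero series all the \<open>b k\<close> are zero and lie outside
      \<open>Hstab\<close>; the nonzero constants 1/(k + 1) approximate it instead.\<close>
    define ps :: "nat \<Rightarrow> complex ^ ('n + 'n) \<Rightarrow> complex" where "ps = (\<lambda>k x. of_real (inverse (real (Suc k))))"
    have "ps k \<in> Hstab UNIV" for k
    proof -
      define e where "e = (\<lambda>\<delta> :: 'n + 'n \<Rightarrow> nat. if \<delta> = (\<lambda>_. 0) then complex_of_real (inverse (real (Suc k))) else 0)"
      have "power_series e x = ps k x" for x
        by (subst power_series_finite[of "{\<lambda>_. 0}"]) (auto simp: e_def ps_def Defs.monom_def split: if_splits)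
      moreover have "finite {\<delta>. e \<delta> \<noteq> 0}"
        by (rule finite_subset[of _ "{\<lambda>_. 0}"]) (auto simp: e_def)
      ultimately have "is_poly UNIV (ps k)"
        unfolding is_poly_iff_power_series by (intro exI[of _ e]) (auto simp: fun_eq_iff)
      then show ?thesis by (simp add: Hstab_def ps_def del: of_nat_Suc)
    qed
    moreover have "uniform_limit S ps (power_series c) sequentially" for S
    proof (rule uniform_limitI)
      fix e :: real assume "e > 0"
      then have "\<forall>\<^sub>F k in sequentially. inverse (real (Suc k)) < e"
        by (intro order_tendstoD(2)[OF LIMSEQ_inverse_real_of_nat])
      then show "\<forall>\<^sub>F k in sequentially. \<forall>x\<in>S. dist (ps k x) (power_series c x) < e"
        by eventually_elim (simp add: ps_def c0 norm_inverse del: of_nat_Suc)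
    qed
    ultimately show ?thesis by blast
  qed
  moreover have "c \<delta> \<in> K" for \<delta> by (simp add: c_def joint_coeff_def a_K)
  ultimately have "power_series c \<in> Hbar K"
    unfolding Hbar_def using entire_coeffs_has_coeffs[OF ent] by blast
  then show ?thesis
    unfolding fps_in_def c_def[symmetric] using entire_coeffs_has_coeffs[OF ent] by blast
qed

theorem theorem5p1:
  fixes K :: "complex set"
    and a :: "('n::finite \<Rightarrow> nat) \<Rightarrow> ('n \<Rightarrow> nat) \<Rightarrow> complex"
  assumes K: "K = \<real> \<or> K = UNIV"
    and a_K: "\<And>\<gamma> \<alpha>. a \<gamma> \<alpha> \<in> K"
    and a_poly: "\<And>\<alpha>. finite {\<gamma>. a \<gamma> \<alpha> \<noteq> 0}"
  shows "fps_in (joint_coeff a) (Hbar K) \<longleftrightarrow>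
         (\<forall>\<beta>. trunc_poly a \<beta> \<in> Hstab K \<union> {\<lambda>x. 0})"
proof -
  have tK: "trunc_coeff a \<beta> \<delta> \<in> K" for \<beta> \<delta>
    using K a_K by (auto simp: trunc_coeff_def joint_coeff_def)
  note trunc = trunc_poly_power_series[of a, OF a_poly]
  have iff: "trunc_poly a \<beta> \<in> Hstab K \<union> {\<lambda>x. 0} \<longleftrightarrow> stable_or_zero (power_series (trunc_coeff a \<beta>))" for \<beta>
    unfolding trunc(2) by (rule mem_Hstab_or_zero_iff[OF trunc(1) tK])
  show ?thesis
    unfolding iff using Hbar_imp_trunc_stable trunc_stable_imp_Hbar[OF a_K trunc(1)] by blast
qed

end
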